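(* Suppose that $F(z)=\mathbb{E}[F(z,\xi)]$, $\mathbb{E}\|F(z,\xi)-F(z)\|^2\le\sigma^2$ for all $z$, and that $F$ is boundedly Lipschitz with constants $L$ and $D$: $\|F(z_1)-F(z_2)\|^2\le L^2\|z_1-z_2\|^2+D^2$ for all $z_1,z_2\in\mathcal Z$. Let the iterates be generated by Past-ES: $z^{-1/2}=z^0\in\mathcal Z$ and, for $k=0,\dots,K-1$, $$z^{k+1/2}=\mathrm{prox}_{\gamma h}(z^k-\gamma F(z^{k-1/2},\xi_{k-1/2})),\qquad z^{k+1}=\mathrm{prox}_{\gamma h}(z^k-\gamma F(z^{k+1/2},\xi_{k+1/2})).$$ Then: (i) in the strongly monotone case with $0<\gamma\le\min\left\{\frac{1}{12L\sqrt2};\frac{1}{4(\mu_F+\mu_h)}\right\}$, $$\mathbb{E}\|z^K-z^*\|^2\le\left(1-\gamma\cdot\frac{\mu_F+\mu_h}{16}\right)^{K-1}\|z^0-z^*\|^2+\frac{192\gamma(37\sigma^2+12D^2)}{\mu_F+\mu_h};$$ (ii) in the monotone case with $0<\gamma\le\frac{1}{12L\sqrt2}$, $$\mathbb{E}[\mathrm{Gap}(\hat z^K)]\le\frac{8\max_{u\in\mathcal C}\|z^0-u\|^2+72\gamma^2\,\mathbb{E}[\sigma_0^2]}{\gamma K}+\gamma(216D^2+691\sigma^2),\qquad\hat z^K=\frac1K\sum_{k=0}^{K-1}z^{k+1/2},$$ where $\sigma_0^2=\|F(z^{-1/2})-F(z^{1/2})\|^2$.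
   Context: $h:\mathbb{R}^d\to\mathbb{R}\cup\{+\infty\}$ is proper, lower semicontinuous, convex; $F:\mathbb{R}^d\to\mathbb{R}^d$; $\mathcal Z\subseteq\mathbb{R}^d$ is nonempty, closed, convex, with $\mathrm{dom}\,h\subseteq\mathcal Z$. $z^*\in\mathcal Z$ is a solution of the variational inequality $\langle F(z^* ),z-z^*\rangle+h(z)-h(z^* )\ge0$ for all $z\in\mathcal Z$. $\mathrm{prox}_{\gamma h}(z)=\arg\min_x\{\gamma h(x)+\frac12\|z-x\|^2\}$. Strongly monotone case: there are $\mu_F,\mu_h\ge0$ with $\mu_F+\mu_h>0$ such that for all $z_1,z_2\in\mathcal Z$: $\langle F(z_1)-F(z_2),z_1-z_2\rangle\ge\mu_F\|z_1-z_2\|^2$ and $h(z_1)-h(z_2)-\langle\nabla h(z_2),z_1-z_2\rangle\ge\frac{\mu_h}{2}\|z_1-z_2\|^2$ ($\nabla h$ denotes a subgradient). Monotone case: the same with $\mu_F=\mu_h=0$. $\mathrm{Gap}(z)=\max_{u\in\mathcal C}[\langle F(u),z-u\rangle+h(z)-h(u)]$, where $\mathcal C$ is a compact subset of $\mathcal Z$ containing $z^*$. $z^0$ is deterministic, $K\ge1$, and the samples $\xi_{-1/2},\xi_{1/2},\xi_{3/2},\dots$ are independent draws of $\xi$. The scalar $\sigma^2$ is the noise variance bound and is unrelated to $\sigma_0^2$. If $L=0$, $\frac1L$ is read as $+\infty$. *)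

theory Defs
  imports "HOL-Probability.Probability"
begin

text \<open>
  Functions with values in the reals extended by \<open>+\<infinity>\<close> are modelled with values in \<open>ereal\<close>;
  properness excludes \<open>-\<infinity>\<close>.
\<close>

definition proper_fun :: "('a \<Rightarrow> ereal) \<Rightarrow> bool" where
  "proper_fun h \<longleftrightarrow> (\<forall>x. h x \<noteq> -\<infinity>) \<and> (\<exists>x. h x \<noteq> \<infinity>)"

definition lsc_fun :: "('a::topological_space \<Rightarrow> ereal) \<Rightarrow> bool" where
  "lsc_fun h \<longleftrightarrow> (\<forall>x. h x \<le> Liminf (at x) h)"

definition convex_fun :: "('a::real_vector \<Rightarrow> ereal) \<Rightarrow> bool" where
  "convex_fun h \<longleftrightarrow> (\<forall>x y. \<forall>t::real. 0 < t \<longrightarrow> t < 1 \<longrightarrow>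
     h ((1 - t) *\<^sub>R x + t *\<^sub>R y) \<le> ereal (1 - t) * h x + ereal t * h y)"

definition edom :: "('a \<Rightarrow> ereal) \<Rightarrow> 'a set" where
  "edom h = {x. h x < \<infinity>}"

definition subdiff :: "('a::real_inner \<Rightarrow> ereal) \<Rightarrow> 'a \<Rightarrow> 'a set" where
  "subdiff h x = {g. \<forall>y. h y \<ge> h x + ereal (g \<bullet> (y - x))}"

text \<open>For proper, lower semicontinuous, convex \<open>h\<close> and \<open>\<gamma> > 0\<close> the minimiser exists and is unique.\<close>

definition prox :: "real \<Rightarrow> ('a::real_normed_vector \<Rightarrow> ereal) \<Rightarrow> 'a \<Rightarrow> 'a" where
  "prox \<gamma> h z = arg_min (\<lambda>x. ereal \<gamma> * h x + ereal (1 / 2 * (norm (z - x))\<^sup>2)) (\<lambda>_. True)"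

definition vi_solution ::
    "'a::real_inner set \<Rightarrow> ('a \<Rightarrow> 'a) \<Rightarrow> ('a \<Rightarrow> ereal) \<Rightarrow> 'a \<Rightarrow> bool" where
  "vi_solution Z F h zs \<longleftrightarrow> zs \<in> Z \<and> (\<forall>z\<in>Z. ereal (F zs \<bullet> (z - zs)) + h z - h zs \<ge> 0)"

definition strongly_monotone_on ::
    "'a::real_inner set \<Rightarrow> ('a \<Rightarrow> 'a) \<Rightarrow> real \<Rightarrow> bool" where
  "strongly_monotone_on Z F \<mu> \<longleftrightarrow>
     (\<forall>z1\<in>Z. \<forall>z2\<in>Z. (F z1 - F z2) \<bullet> (z1 - z2) \<ge> \<mu> * (norm (z1 - z2))\<^sup>2)"

text \<open>
  The inequality is required for every subgradient \<open>g\<close> at \<open>z2\<close>. If \<open>h\<close> is proper, \<open>h z2\<close> is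
  finite wherever a subgradient exists, so the difference is never \<open>\<infinity> - \<infinity>\<close>.
\<close>

definition strongly_convex_fun_on ::
    "'a::real_inner set \<Rightarrow> ('a \<Rightarrow> ereal) \<Rightarrow> real \<Rightarrow> bool" where
  "strongly_convex_fun_on Z h \<mu> \<longleftrightarrow>
     (\<forall>z1\<in>Z. \<forall>z2\<in>Z. \<forall>g\<in>subdiff h z2.
        h z1 - h z2 - ereal (g \<bullet> (z1 - z2)) \<ge> ereal (\<mu> / 2 * (norm (z1 - z2))\<^sup>2))"

definition boundedly_lipschitz_on ::
    "'a::real_normed_vector set \<Rightarrow> ('a \<Rightarrow> 'a) \<Rightarrow> real \<Rightarrow> real \<Rightarrow> bool" where
  "boundedly_lipschitz_on Z F L D \<longleftrightarrow>
     (\<forall>z1\<in>Z. \<forall>z2\<in>Z. (norm (F z1 - F z2))\<^sup>2 \<le> L\<^sup>2 * (norm (z1 - z2))\<^sup>2 + D\<^sup>2)"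

text \<open>
  \<open>F\<close> need not be continuous, so the maximum over \<open>C\<close> may fail to be attained; it is read as a
  supremum. A point \<open>u\<close> outside the domain of \<open>h\<close> contributes \<open>-\<infinity>\<close> when \<open>h z\<close> is finite.
\<close>

definition Gap ::
    "('a::real_inner \<Rightarrow> 'a) \<Rightarrow> ('a \<Rightarrow> ereal) \<Rightarrow> 'a set \<Rightarrow> 'a \<Rightarrow> ereal" where
  "Gap F h C z = (SUP u\<in>C. ereal (F u \<bullet> (z - u)) + h z - h u)"

text \<open>
  \<open>P\<close> is the distribution of \<open>\<xi>\<close> and \<open>G z s\<close> is the sample value at \<open>z\<close>
  for \<open>\<xi> = s\<close>. The samples are unbiased for \<open>F\<close> with variance at most \<open>v\<close>.
\<close>

definition unbiased_sampling ::
    "'s measure \<Rightarrow> ('a::euclidean_space \<Rightarrow> 's \<Rightarrow> 'a) \<Rightarrow> ('a \<Rightarrow> 'a) \<Rightarrow> real \<Rightarrow> bool" where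
  "unbiased_sampling P G F v \<longleftrightarrow>
     prob_space P \<and>
     (\<lambda>(z, s). G z s) \<in> borel_measurable (borel \<Otimes>\<^sub>M P) \<and>
     (\<forall>z. integrable P (G z) \<and> F z = (\<integral>s. G z s \<partial>P)) \<and>
     (\<forall>z. integrable P (\<lambda>s. (norm (G z s - F z))\<^sup>2) \<and>
          (\<integral>s. (norm (G z s - F z))\<^sup>2 \<partial>P) \<le> v)"

definition iid_samples ::
    "'w measure \<Rightarrow> 's measure \<Rightarrow> (nat \<Rightarrow> 'w \<Rightarrow> 's) \<Rightarrow> bool" where
  "iid_samples M P \<xi> \<longleftrightarrow>
     prob_space.indep_vars M (\<lambda>_. P) \<xi> UNIV \<and> (\<forall>k. distr M P (\<xi> k) = P)"

text \<open>
  Half-integer indices are shifted by one half: \<open>zh k\<close> stands for \<open>z^(k-1/2)\<close> and \<open>s k\<close> for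
  the sample with index \<open>k-1/2\<close>.
\<close>

definition past_es ::
    "real \<Rightarrow> ('a::real_normed_vector \<Rightarrow> ereal) \<Rightarrow> ('a \<Rightarrow> 's \<Rightarrow> 'a) \<Rightarrow> (nat \<Rightarrow> 's) \<Rightarrow>
     'a \<Rightarrow> nat \<Rightarrow> (nat \<Rightarrow> 'a) \<Rightarrow> (nat \<Rightarrow> 'a) \<Rightarrow> bool" where
  "past_es \<gamma> h G s z0 K z zh \<longleftrightarrow>
     z 0 = z0 \<and> zh 0 = z0 \<and>
     (\<forall>k<K. zh (Suc k) = prox \<gamma> h (z k - \<gamma> *\<^sub>R G (zh k) (s k)) \<and>
            z (Suc k) = prox \<gamma> h (z k - \<gamma> *\<^sub>R G (zh (Suc k)) (s (Suc k))))"

end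

theory Submission
  imports Defs
begin

text \<open>
  Write \<open>x, y\<close> for \<open>z^k, z^(k-1/2)\<close> and \<open>x', y'\<close> for \<open>z^(k+1), z^(k+1/2)\<close>. Adding the variational
  inequalities of the two prox steps bounds \<open>|x' - u|^2 + 2 \<gamma> (<g', y' - u> + h y' - h u)\<close> by
  \<open>|x - u|^2 - |x - y'|^2 - |x' - y'|^2 - 2 \<gamma> <g' - g, x' - y'>\<close>. Half of \<open>|x' - y'|^2\<close> is kept,
  the other half absorbs the inner product. The remaining \<open>2 \<gamma>^2 |g' - g|^2\<close> is at most noise and \<open>D\<close>
  terms plus a small multiple of \<open>|x - y'|^2 + |x - y|^2\<close>, so that \<open>|x - u|^2 + 1/2 |x - y|^2\<close> is a
  Lyapunov function. In the strongly monotone case it contracts in expectation. In the monotone case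
  one sums over \<open>k\<close>; to take the supremum over \<open>u\<close> before the expectation, the noise term
  \<open>\<Sum>k. <e_k, y_k - u>\<close> is split at \<open>z^0\<close>, and \<open><\<Sum>k. e_k, z^0 - u>\<close> is handled by Young's
  inequality and orthogonality of the \<open>e_k\<close>.
\<close>

text \<open>Each half step uses a sample from the previous iteration. So \<open>F y' - F y\<close>
  is controlled only by passing from \<open>y'\<close> to \<open>y\<close> through \<open>x\<close>,
  and \<open>|x - y|^2\<close> has to be inherited from the step before. The step-size limit amounts
  to 288 \<gamma>^2 L^2 \<le> 1. The inherited term then enters with factor 1/24 against the 1/2
  that was kept, and the slack pays for the contraction. Expectations rest on \<open>zh k\<close>
  depending only on samples with index below \<open>k\<close>. Any random element so determined
  forms with \<open>\<xi> k\<close> a pair whose law is a product measure, and Fubini integrates the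
  noise with the point frozen. This plays the part of conditional expectation. \<open>F\<close> may
  be discontinuous, so measurability of \<open>F\<close> and of the gap needs its own argument.
  \<open>h\<close> may be infinite, so real values of \<open>h\<close> are taken on
  \<open>edom h\<close>, where every prox point lies. At the solution \<open>- F zs\<close> is a
  subgradient of \<open>h\<close>, which connects strong convexity with the variational inequality.
  The estimates reached have smaller constants than those claimed; the theorem follows by weakening
  them.\<close>

section \<open>Proximal maps\<close>

text \<open>The topological form of lower semicontinuity on which both the compactness and the Borel
  measurability arguments rely. \<open>Liminf (at x)\<close> ignores \<open>x\<close> itself, where
  the inequality holds by choice of \<open>x\<close>.\<close>

lemma lsc_fun_open_greater:
  fixes h :: "'a::topological_space \<Rightarrow> ereal"
  assumes "lsc_fun h"
  shows "open {x. c < h x}"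
proof (subst open_subopen, intro ballI)
  show "\<exists>T. open T \<and> x \<in> T \<and> T \<subseteq> {x. c < h x}" if "x \<in> {x. c < h x}" for x
  proof -
    have "h x \<le> Liminf (at x) h"
      using assms by (simp add: lsc_fun_def)
    then have "eventually (\<lambda>y. c < h y) (at x)"
      using that unfolding le_Liminf_iff by auto
    then obtain S where "open S" "x \<in> S" "\<And>y. y \<in> S \<Longrightarrow> y \<noteq> x \<Longrightarrow> c < h y"
      unfolding eventually_at_topological by auto
    then show ?thesis
      using that by (intro exI[of _ S]) auto
  qed
qed

text \<open>Without a minimum the open sets \<open>{x. f y < f x}\<close> with
  \<open>y \<in> S\<close> cover \<open>S\<close>. In a finite subcover the index with least value
  is itself covered by an index of smaller value.\<close>

lemma compact_attains_min_of_open_greater: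
  fixes f :: "'a::topological_space \<Rightarrow> 'b::linorder"
  assumes f: "\<And>c. open {x. c < f x}" and S: "compact S" "S \<noteq> {}"
  shows "\<exists>x\<in>S. \<forall>y\<in>S. f x \<le> f y"
proof (rule ccontr)
  assume "\<not> ?thesis"
  then have ex: "\<forall>x\<in>S. \<exists>y\<in>S. f y < f x"
    by (auto simp: not_le)
  have "S \<subseteq> (\<Union>y\<in>S. {x. f y < f x})"
    using ex by auto
  then obtain T where T: "T \<subseteq> S" "finite T" "S \<subseteq> (\<Union>y\<in>T. {x. f y < f x})"
    using compactE_image[OF S(1), of S "\<lambda>y. {x. f y < f x}"] f by metis
  have "T \<noteq> {}"
    using T S by auto
  then have "Min (f ` T) \<in> f ` T"
    using T by (intro Min_in) auto
  then obtain y where y: "y \<in> T" "f y = Min (f ` T)"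
    by auto
  then obtain y' where "y' \<in> T" "f y' < f y"
    using T by blast
  then show False
    using y T Min_le[of "f ` T" "f y'"] by (simp add: not_le[symmetric])
qed

text \<open>With \<open>b\<close> the minimum on the unit ball at \<open>x0\<close>, a point farther
  away is joined to \<open>x0\<close> by a segment that meets the sphere at value at least
  \<open>b\<close>. Convexity then limits the decrease beyond the sphere to a linear rate, which the
  quadratic term of the prox objective beats.\<close>

lemma convex_lsc_linear_lower_bound:
  fixes h :: "'a::euclidean_space \<Rightarrow> ereal"
  assumes "proper_fun h" "lsc_fun h" "convex_fun h"
  obtains x0 r0 b where "h x0 = ereal r0" "b \<le> r0"
    "\<And>x. ereal (b - (r0 - b) * norm (x - x0)) \<le> h x"
proof -
  obtain x0 where x0: "h x0 \<noteq> \<infinity>"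
    using assms by (auto simp: proper_fun_def)
  have nm: "h x \<noteq> -\<infinity>" for x
    using assms by (auto simp: proper_fun_def)
  obtain r0 where r0: "h x0 = ereal r0"
    using x0 nm[of x0] by (cases "h x0") auto
  obtain m where m: "m \<in> cball x0 1" "\<forall>y\<in>cball x0 1. h m \<le> h y"
    using compact_attains_min_of_open_greater[OF lsc_fun_open_greater[OF assms(2)], of "cball x0 1"]
    by auto
  have "h m \<le> h x0"
    using m by auto
  then obtain b where b: "h m = ereal b"
    using r0 nm[of m] by (cases "h m") auto
  have br: "b \<le> r0"
    using \<open>h m \<le> h x0\<close> b r0 by simp
  have "ereal (b - (r0 - b) * norm (x - x0)) \<le> h x" for x
  proof (cases "x \<in> cball x0 1")
    case True
    then have "ereal b \<le> h x"
      using m b by auto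
    moreover have "b - (r0 - b) * norm (x - x0) \<le> b"
      using br by simp
    ultimately show ?thesis
      by (meson ereal_less_eq(3) order_trans)
  next
    case False
    define r where "r = norm (x - x0)"
    have r: "r > 1"
      using False by (simp add: r_def dist_norm norm_minus_commute)
    show ?thesis
    proof (cases "h x")
      case (real v)
      have "x0 + (1/r) *\<^sub>R (x - x0) \<in> cball x0 1"
        using r by (simp add: dist_norm r_def)
      moreover have "x0 + (1/r) *\<^sub>R (x - x0) = (1 - 1/r) *\<^sub>R x0 + (1/r) *\<^sub>R x"
        by (simp add: algebra_simps)
      ultimately have "ereal b \<le> h ((1 - 1/r) *\<^sub>R x0 + (1/r) *\<^sub>R x)"
        using m b by auto
      also have "\<dots> \<le> ereal (1 - 1/r) * h x0 + ereal (1/r) * h x"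
        using assms(3) r unfolding convex_fun_def by simp
      finally have "b \<le> (1 - 1/r) * r0 + (1/r) * v"
        by (simp add: r0 real)
      then have "r * b \<le> r * ((1 - 1/r) * r0 + (1/r) * v)"
        using r by (intro mult_left_mono) auto
      also have "\<dots> = (r - 1) * r0 + v"
        using r by (simp add: field_simps)
      finally have "b - (r0 - b) * r \<le> v"
        using br by (simp add: algebra_simps)
      then show ?thesis
        by (simp add: real r_def)
    qed (use nm in auto)
  qed
  then show thesis
    using that r0 br by blast
qed

text \<open>A real \<open>r\<close> just below \<open>h x\<close> separates the two summands, so the
  superlevel set is a union of intersections of a superlevel set of \<open>h\<close> with one of a
  continuous function.\<close>

lemma open_greater_prox_objective:
  fixes h :: "'a::real_normed_vector \<Rightarrow> ereal"
  assumes "lsc_fun h" "\<gamma> > 0" "\<And>x. h x \<noteq> -\<infinity>"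
  shows "open {x. c < ereal \<gamma> * h x + ereal (1 / 2 * (norm (w - x))\<^sup>2)}"
proof -
  let ?q = "\<lambda>x. 1 / 2 * (norm (w - x))\<^sup>2"
  have "{x. c < ereal \<gamma> * h x + ereal (?q x)} =
        (\<Union>r. {x. ereal r < h x} \<inter> {x. c < ereal (\<gamma> * r + ?q x)})"
  proof (intro set_eqI iffI)
    fix x assume "x \<in> {x. c < ereal \<gamma> * h x + ereal (?q x)}"
    then have x: "c < ereal \<gamma> * h x + ereal (?q x)"
      by simp
    have "\<exists>r. ereal r < h x \<and> c < ereal (\<gamma> * r + ?q x)"
    proof (cases c)
      case (real c')
      show ?thesis
      proof (cases "h x")
        case (real v)
        then have "c' < \<gamma> * v + ?q x"
          using x \<open>c = _\<close> by simp
        then have "(c' - ?q x) / \<gamma> < v"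
          using assms(2) by (simp add: field_simps)
        then obtain r where "(c' - ?q x) / \<gamma> < r" "r < v"
          using dense by blast
        then show ?thesis
          using assms(2) real \<open>c = _\<close> by (intro exI[of _ r]) (simp add: field_simps)
      next
        case PInf
        then show ?thesis
          using assms(2) real
          by (intro exI[of _ "(c' - ?q x) / \<gamma> + 1"]) (simp add: field_simps)
      qed (use assms in auto)
    next
      case MInf
      show ?thesis
        using ereal_dense2[of "-\<infinity>" "h x"] assms(3)[of x] MInf by auto
    qed (use x in auto)
    then show "x \<in> (\<Union>r. {x. ereal r < h x} \<inter> {x. c < ereal (\<gamma> * r + ?q x)})"
      by auto
  next
    fix x assume "x \<in> (\<Union>r. {x. ereal r < h x} \<inter> {x. c < ereal (\<gamma> * r + ?q x)})"
    then obtain r where r: "ereal r < h x" "c < ereal (\<gamma> * r + ?q x)"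
      by auto
    have "ereal \<gamma> * ereal r \<le> ereal \<gamma> * h x"
      using r assms(2) by (intro ereal_mult_left_mono) auto
    then have "ereal (\<gamma> * r) + ereal (?q x) \<le> ereal \<gamma> * h x + ereal (?q x)"
      by (intro add_mono) auto
    then show "x \<in> {x. c < ereal \<gamma> * h x + ereal (?q x)}"
      using r by auto
  qed
  moreover have "open {x. c < ereal (\<gamma> * r + ?q x)}" for r
    by (intro open_Collect_less continuous_intros)
  ultimately show ?thesis
    by (auto simp only: intro!: open_UN open_Int lsc_fun_open_greater[OF assms(1)])
qed

text \<open>As \<open>prox\<close> is a choice among minimisers, existence is what has to be shown:
  a minimiser over a large ball is global because the objective is coercive.\<close>

lemma prox_is_minimiser:
  fixes h :: "'a::euclidean_space \<Rightarrow> ereal"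
  assumes h: "proper_fun h" "lsc_fun h" "convex_fun h" and \<gamma>: "\<gamma> > 0"
  shows "ereal \<gamma> * h (prox \<gamma> h w) + ereal (1 / 2 * (norm (w - prox \<gamma> h w))\<^sup>2)
       \<le> ereal \<gamma> * h x + ereal (1 / 2 * (norm (w - x))\<^sup>2)"
proof -
  let ?\<phi> = "\<lambda>x. ereal \<gamma> * h x + ereal (1 / 2 * (norm (w - x))\<^sup>2)"
  obtain x0 r0 b where x0: "h x0 = ereal r0" "b \<le> r0"
    and lower: "\<And>x. ereal (b - (r0 - b) * norm (x - x0)) \<le> h x"
    using convex_lsc_linear_lower_bound[OF h] by blast
  define n where "n = norm (w - x0)"
  \<comment> \<open>For \<open>r > \<rho>\<close> the quantity
    \<open>r / 2 - n - \<gamma> * (r0 - b)\<close> exceeds both 1 and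
    \<open>\<gamma> * (r0 - b)\<close>. This makes the objective at distance \<open>r\<close> from
    \<open>x0\<close> at least its value at \<open>x0\<close>.\<close>
  define \<rho> where "\<rho> = 2 * n + 4 * \<gamma> * (r0 - b) + 2"
  have n: "n \<ge> 0" and B: "\<gamma> * (r0 - b) \<ge> 0"
    using x0 \<gamma> by (auto simp: n_def)
  then have \<rho>: "\<rho> \<ge> 2"
    by (simp add: \<rho>_def)
  have nm: "h x \<noteq> -\<infinity>" for x
    using h by (auto simp: proper_fun_def)
  have "cball x0 \<rho> \<noteq> {}"
    using \<rho> by auto
  then obtain p where p: "p \<in> cball x0 \<rho>" "\<forall>y\<in>cball x0 \<rho>. ?\<phi> p \<le> ?\<phi> y"
    using compact_attains_min_of_open_greater[OF open_greater_prox_objective[OF h(2) \<gamma> nm], where S = "cball x0 \<rho>"]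
      compact_cball by blast
  have "?\<phi> p \<le> ?\<phi> y" for y
  proof (cases "y \<in> cball x0 \<rho>")
    case False
    define r where "r = norm (y - x0)"
    have r: "r > \<rho>"
      using False by (simp add: r_def dist_norm norm_minus_commute)
    have "r - n \<le> norm (w - y)"
      unfolding r_def n_def using norm_triangle_ineq[of "y - w" "w - x0"]
      by (simp add: norm_minus_commute)
    moreover have "r - n \<ge> 0"
      using r n B by (simp add: \<rho>_def)
    ultimately have q: "(r - n)\<^sup>2 \<le> (norm (w - y))\<^sup>2"
      by (intro power_mono)
    have "1 \<le> r / 2 - n - \<gamma> * (r0 - b)" "\<gamma> * (r0 - b) \<le> r / 2 - n - \<gamma> * (r0 - b)"
      using r n B by (auto simp: \<rho>_def)
    then have "1 * (\<gamma> * (r0 - b)) \<le> r * (r / 2 - n - \<gamma> * (r0 - b))"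
      using r \<rho> B by (intro mult_mono) auto
    then have "\<gamma> * r0 + 1/2 * n\<^sup>2 \<le> \<gamma> * (b - (r0 - b) * r) + 1/2 * (r - n)\<^sup>2"
      by (simp add: power2_eq_square field_simps)
    also have "\<dots> \<le> \<gamma> * (b - (r0 - b) * r) + 1/2 * (norm (w - y))\<^sup>2"
      using q by simp
    finally have "?\<phi> x0 \<le> ereal \<gamma> * ereal (b - (r0 - b) * r) + ereal (1/2 * (norm (w - y))\<^sup>2)"
      by (simp add: x0 n_def)
    also have "\<dots> \<le> ?\<phi> y"
      using lower[of y] \<gamma> by (intro add_mono ereal_mult_left_mono) (auto simp: r_def)
    finally have "?\<phi> x0 \<le> ?\<phi> y" .
    moreover have "?\<phi> p \<le> ?\<phi> x0"
      using p \<rho> by auto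
    ultimately show ?thesis
      by (rule order_trans[rotated])
  qed (use p in auto)
  then have "is_arg_min ?\<phi> (\<lambda>_. True) p"
    by (simp add: is_arg_min_def not_less)
  then have "is_arg_min ?\<phi> (\<lambda>_. True) (prox \<gamma> h w)"
    unfolding prox_def arg_min_def by (rule someI)
  then show ?thesis
    by (simp add: is_arg_min_def not_less)
qed

lemma prox_in_edom:
  fixes h :: "'a::euclidean_space \<Rightarrow> ereal"
  assumes h: "proper_fun h" "lsc_fun h" "convex_fun h" and \<gamma>: "\<gamma> > 0"
  shows "prox \<gamma> h w \<in> edom h"
proof -
  obtain x0 where "h x0 \<noteq> \<infinity>" "h x0 \<noteq> -\<infinity>"
    using h by (auto simp: proper_fun_def)
  then have "ereal \<gamma> * h x0 + ereal (1 / 2 * (norm (w - x0))\<^sup>2) < \<infinity>"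
    by (cases "h x0") auto
  then have "ereal \<gamma> * h (prox \<gamma> h w) + ereal (1 / 2 * (norm (w - prox \<gamma> h w))\<^sup>2) < \<infinity>"
    using prox_is_minimiser[OF h \<gamma>, of w x0] by (rule le_less_trans[rotated])
  then show ?thesis
    using \<gamma> by (auto simp: edom_def)
qed

lemma edom_real:
  assumes "proper_fun h" "x \<in> edom h"
  shows "h x = ereal (real_of_ereal (h x))"
  using assms by (cases "h x") (auto simp: proper_fun_def edom_def)

lemma convex_on_edom:
  fixes h :: "'a::real_vector \<Rightarrow> ereal"
  assumes h: "proper_fun h" "convex_fun h"
  shows "convex_on (edom h) (\<lambda>x. real_of_ereal (h x))"
proof -
  have *: "h ((1 - t) *\<^sub>R x + t *\<^sub>R y) \<le> ereal ((1 - t) * real_of_ereal (h x) + t * real_of_ereal (h y))"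
    if xy: "x \<in> edom h" "y \<in> edom h" and t: "0 < t" "t < 1" for x y t
  proof -
    obtain a b where "h x = ereal a" "h y = ereal b"
      using edom_real[OF h(1) xy(1)] edom_real[OF h(1) xy(2)] by blast
    then show ?thesis
      using h(2)[unfolded convex_fun_def, rule_format, OF t, of x y] by simp
  qed
  have **: "(1 - t) *\<^sub>R x + t *\<^sub>R y \<in> edom h"
    if "x \<in> edom h" "y \<in> edom h" "0 < t" "t < 1" for x y t
    using *[OF that] by (auto simp: edom_def)
  have "convex (edom h)"
    unfolding convex_alt using ** by (metis less_eq_real_def scaleR_one scaleR_zero_left
        add.left_neutral add.right_neutral diff_zero diff_self)
  then show ?thesis
    using * ** edom_real[OF h(1)] by (intro convex_onI) (metis ereal_less_eq(3))+
qed

text \<open>First-order optimality: compare the minimiser with a point moved by a fraction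
  \<open>t\<close> towards \<open>u\<close>, divide by \<open>t\<close>, and let \<open>t\<close>
  tend to 0.\<close>

lemma prox_variational_inequality:
  fixes h :: "'a::euclidean_space \<Rightarrow> ereal"
  assumes h: "proper_fun h" "lsc_fun h" "convex_fun h" and \<gamma>: "\<gamma> > 0" and u: "u \<in> edom h"
  shows "(w - prox \<gamma> h w) \<bullet> (u - prox \<gamma> h w)
     \<le> \<gamma> * (real_of_ereal (h u) - real_of_ereal (h (prox \<gamma> h w)))"
proof -
  let ?H = "\<lambda>x. real_of_ereal (h x)"
  let ?p = "prox \<gamma> h w"
  have p: "?p \<in> edom h"
    by (rule prox_in_edom[OF h \<gamma>])
  define A where "A = \<gamma> * (?H ?p - ?H u) + (w - ?p) \<bullet> (u - ?p)"
  define B where "B = (norm (u - ?p))\<^sup>2 / 2"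
  have AB: "A \<le> t * B" if t: "0 < t" "t < 1" for t
  proof -
    define x where "x = (1 - t) *\<^sub>R ?p + t *\<^sub>R u"
    have cvx: "?H x \<le> (1 - t) * ?H ?p + t * ?H u"
      unfolding x_def using convex_onD[OF convex_on_edom[OF h(1,3)], of t ?p u] t p u by auto
    have "x \<in> edom h"
      unfolding x_def using convex_on_edom[OF h(1,3)] t p u
      by (auto simp: convex_on_def convex_alt)
    then have "\<gamma> * ?H ?p + 1/2 * (norm (w - ?p))\<^sup>2 \<le> \<gamma> * ?H x + 1/2 * (norm (w - x))\<^sup>2"
      using prox_is_minimiser[OF h \<gamma>, of w x] edom_real[OF h(1) p] edom_real[OF h(1), of x]
      by (metis (no_types, lifting) ereal_less_eq(3) plus_ereal.simps(1) times_ereal.simps(1))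
    also have "\<dots> \<le> \<gamma> * ((1 - t) * ?H ?p + t * ?H u) + 1/2 * (norm (w - x))\<^sup>2"
      using cvx \<gamma> by simp
    also have "w - x = (w - ?p) - t *\<^sub>R (u - ?p)"
      by (simp add: x_def algebra_simps)
    also have "(norm ((w - ?p) - t *\<^sub>R (u - ?p)))\<^sup>2
        = (norm (w - ?p))\<^sup>2 - 2 * t * ((w - ?p) \<bullet> (u - ?p)) + t\<^sup>2 * (norm (u - ?p))\<^sup>2"
      unfolding power2_norm_eq_inner
      by (simp add: inner_diff_left inner_diff_right inner_commute power2_eq_square algebra_simps)
    finally have "t * A \<le> t * (t * B)"
      by (simp add: A_def B_def power2_eq_square algebra_simps)
    then show ?thesis
      using t by simp
  qed
  have "A \<le> 0"
  proof (rule ccontr)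
    assume A: "\<not> A \<le> 0"
    have B: "B \<ge> 0"
      by (simp add: B_def)
    have "A \<le> B / 2"
      using AB[of "1/2"] by simp
    \<comment> \<open>In place of a limit one value of \<open>t\<close> suffices: at
      \<open>t = A / (2 * B)\<close> the bound \<open>A \<le> t * B\<close> reads
      \<open>A \<le> A / 2\<close>.\<close>
    then have "0 < A / (2 * B)" "A / (2 * B) < 1" "B > 0"
      using A by (auto simp: field_simps)
    then show False
      using AB[of "A / (2 * B)"] A by simp
  qed
  then show ?thesis
    by (simp add: A_def algebra_simps)
qed

text \<open>Adding the two optimality inequalities, each tested at the other prox point, cancels
  \<open>h\<close> and leaves firm nonexpansiveness. Measurability and square integrability of the
  iterates come from here.\<close>

lemma prox_nonexpansive:
  fixes h :: "'a::euclidean_space \<Rightarrow> ereal"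
  assumes h: "proper_fun h" "lsc_fun h" "convex_fun h" and \<gamma>: "\<gamma> > 0"
  shows "norm (prox \<gamma> h v - prox \<gamma> h w) \<le> norm (v - w)"
proof -
  let ?p = "prox \<gamma> h v" and ?q = "prox \<gamma> h w"
  have "(v - ?p) \<bullet> (?q - ?p) + (w - ?q) \<bullet> (?p - ?q) \<le> 0"
    using prox_variational_inequality[OF h \<gamma> prox_in_edom[OF h \<gamma>], of v w]
      prox_variational_inequality[OF h \<gamma> prox_in_edom[OF h \<gamma>], of w v]
    by (simp add: algebra_simps)
  then have "(norm (?p - ?q))\<^sup>2 \<le> (v - w) \<bullet> (?p - ?q)"
    unfolding power2_norm_eq_inner
    by (simp add: inner_diff_left inner_diff_right inner_commute algebra_simps)
  also have "\<dots> \<le> norm (v - w) * norm (?p - ?q)"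
    by (rule norm_cauchy_schwarz)
  finally have "norm (?p - ?q) * norm (?p - ?q) \<le> norm (v - w) * norm (?p - ?q)"
    by (simp add: power2_eq_square)
  then show ?thesis
    by (cases "norm (?p - ?q) = 0") (simp_all add: mult_le_cancel_right)
qed

lemma continuous_on_prox:
  fixes h :: "'a::euclidean_space \<Rightarrow> ereal"
  assumes h: "proper_fun h" "lsc_fun h" "convex_fun h" and \<gamma>: "\<gamma> > 0"
  shows "continuous_on UNIV (prox \<gamma> h)"
  using prox_nonexpansive[OF h \<gamma>]
  by (intro lipschitz_on_continuous_on[of 1] lipschitz_onI) (auto simp: dist_norm)

section \<open>One step of Past-ES\<close>

lemma norm_add_squared_le:
  fixes a b :: "'a::real_inner"
  shows "(norm (a + b))\<^sup>2 \<le> 2 * (norm a)\<^sup>2 + 2 * (norm b)\<^sup>2"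
proof -
  have "(norm (a + b))\<^sup>2 + (norm (a - b))\<^sup>2 = 2 * (norm a)\<^sup>2 + 2 * (norm b)\<^sup>2"
    unfolding power2_norm_eq_inner by (simp add: algebra_simps inner_commute)
  then show ?thesis
    by (smt (verit) zero_le_power2)
qed

lemma norm_add3_squared_le:
  fixes a b c :: "'a::real_inner"
  shows "(norm (a + b + c))\<^sup>2 \<le> 3 * (norm a)\<^sup>2 + 3 * (norm b)\<^sup>2 + 3 * (norm c)\<^sup>2"
proof -
  have "(norm (a + b + c))\<^sup>2 + ((norm (a - b))\<^sup>2 + (norm (b - c))\<^sup>2 + (norm (a - c))\<^sup>2)
      = 3 * (norm a)\<^sup>2 + 3 * (norm b)\<^sup>2 + 3 * (norm c)\<^sup>2"
    unfolding power2_norm_eq_inner by (simp add: algebra_simps inner_commute)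
  then show ?thesis
    by (smt (verit) zero_le_power2)
qed

lemma past_es_step:
  fixes h :: "'a::euclidean_space \<Rightarrow> ereal"
  assumes h: "proper_fun h" "lsc_fun h" "convex_fun h" and \<gamma>: "\<gamma> > 0"
    and lip: "boundedly_lipschitz_on Z F L D" and step: "288 * (\<gamma>\<^sup>2 * L\<^sup>2) \<le> 1"
    and y: "y \<in> Z" "y' \<in> Z" and u: "u \<in> edom h"
    and y': "y' = prox \<gamma> h (x - \<gamma> *\<^sub>R g)" and x': "x' = prox \<gamma> h (x - \<gamma> *\<^sub>R g')"
  shows "(norm (x' - u))\<^sup>2 + 1/2 * (norm (x' - y'))\<^sup>2
      + 2 * \<gamma> * (g' \<bullet> (y' - u) + real_of_ereal (h y') - real_of_ereal (h u))
    \<le> (norm (x - u))\<^sup>2 + 1/24 * (norm (x - y))\<^sup>2 - 23/24 * (norm (x - y'))\<^sup>2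
      + 6 * \<gamma>\<^sup>2 * ((norm (g' - F y'))\<^sup>2 + (norm (g - F y))\<^sup>2 + D\<^sup>2)"
proof -
  let ?H = "\<lambda>x. real_of_ereal (h x)"
  have x'dom: "x' \<in> edom h"
    unfolding x' by (rule prox_in_edom[OF h \<gamma>])
  have 1: "(x - \<gamma> *\<^sub>R g' - x') \<bullet> (u - x') \<le> \<gamma> * (?H u - ?H x')"
    unfolding x' by (rule prox_variational_inequality[OF h \<gamma> u])
  \<comment> \<open>Testing the half step at \<open>x'\<close> makes \<open>h x'\<close> cancel
    against its occurrence in 1.\<close>
  have 2: "(x - \<gamma> *\<^sub>R g - y') \<bullet> (x' - y') \<le> \<gamma> * (?H x' - ?H y')"
    unfolding y' by (rule prox_variational_inequality[OF h \<gamma> x'dom])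
  define N where "N = (norm (\<gamma> *\<^sub>R (g' - g)))\<^sup>2"
  \<comment> \<open>Young's inequality in disguise: it yields
    \<open>- 2 * \<gamma> * ((g' - g) \<bullet> (x' - y'))\<close> at most half of
    \<open>|x' - y'|^2\<close> plus \<open>2 * N\<close>.\<close>
  have "0 \<le> (norm (x' - y' + 2 *\<^sub>R (\<gamma> *\<^sub>R (g' - g))))\<^sup>2"
    by simp
  also have "\<dots> = (norm (x' - y'))\<^sup>2 + 4 * \<gamma> * ((g' - g) \<bullet> (x' - y')) + 4 * N"
    unfolding N_def power2_norm_eq_inner by (simp add: algebra_simps inner_commute)
  finally have 3: "0 \<le> (norm (x' - y'))\<^sup>2 + 4 * \<gamma> * ((g' - g) \<bullet> (x' - y')) + 4 * N" .
  have 4: "2 * ((x - \<gamma> *\<^sub>R g' - x') \<bullet> (u - x')) + 2 * ((x - \<gamma> *\<^sub>R g - y') \<bullet> (x' - y'))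
     = (norm (x' - u))\<^sup>2 - (norm (x - u))\<^sup>2 + (norm (x - y'))\<^sup>2 + (norm (x' - y'))\<^sup>2
       + 2 * \<gamma> * (g' \<bullet> (y' - u)) + 2 * \<gamma> * ((g' - g) \<bullet> (x' - y'))"
    unfolding power2_norm_eq_inner by (simp add: algebra_simps inner_commute)
  have "g' - g = (g' - F y') + (F y - g) + (F y' - F y)"
    by simp
  then have "(norm (g' - g))\<^sup>2 \<le> 3 * (norm (g' - F y'))\<^sup>2 + 3 * (norm (F y - g))\<^sup>2 + 3 * (norm (F y' - F y))\<^sup>2"
    using norm_add3_squared_le[of "g' - F y'" "F y - g" "F y' - F y"] by simp
  also have "(norm (F y' - F y))\<^sup>2 \<le> L\<^sup>2 * (norm (y' - y))\<^sup>2 + D\<^sup>2"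
    using lip y by (simp add: boundedly_lipschitz_on_def)
  finally have 5: "(norm (g' - g))\<^sup>2
      \<le> 3 * (norm (g' - F y'))\<^sup>2 + 3 * (norm (g - F y))\<^sup>2 + 3 * (L\<^sup>2 * (norm (y' - y))\<^sup>2 + D\<^sup>2)"
    by (simp add: norm_minus_commute)
  have "N = \<gamma>\<^sup>2 * (norm (g' - g))\<^sup>2"
    by (simp add: N_def power_mult_distrib)
  also have "\<dots> \<le> \<gamma>\<^sup>2 * (3 * (norm (g' - F y'))\<^sup>2 + 3 * (norm (g - F y))\<^sup>2 + 3 * (L\<^sup>2 * (norm (y' - y))\<^sup>2 + D\<^sup>2))"
    by (rule mult_left_mono[OF 5]) simp
  finally have 6: "N \<le> 3 * \<gamma>\<^sup>2 * ((norm (g' - F y'))\<^sup>2 + (norm (g - F y))\<^sup>2 + D\<^sup>2)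
      + 3 * ((\<gamma>\<^sup>2 * L\<^sup>2) * (norm (y' - y))\<^sup>2)"
    by (simp add: algebra_simps)
  \<comment> \<open>The Lipschitz part of \<open>2 * N\<close> is 6 \<gamma>^2 L^2 |y' - y|^2, at
    most 1/48 of |y' - y|^2. Passing through \<open>x\<close> doubles this to 1/24 of each of |x -
    y|^2 and |x - y'|^2, whence 23/24 = 1 - 1/24.\<close>
  have "288 * (\<gamma>\<^sup>2 * L\<^sup>2) * (norm (y' - y))\<^sup>2 \<le> 1 * (norm (y' - y))\<^sup>2"
    by (intro mult_right_mono step) simp
  moreover have "(norm (y' - y))\<^sup>2 \<le> 2 * (norm (x - y))\<^sup>2 + 2 * (norm (x - y'))\<^sup>2"
    using norm_add_squared_le[of "x - y" "y' - x"] by (simp add: norm_minus_commute)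
  ultimately have "48 * (3 * ((\<gamma>\<^sup>2 * L\<^sup>2) * (norm (y' - y))\<^sup>2)) \<le> (norm (x - y))\<^sup>2 + (norm (x - y'))\<^sup>2"
    by simp
  with 1 2 3 4 6 show ?thesis
    by (simp add: algebra_simps)
qed

section \<open>Independence and noise\<close>

definition sq_integrable :: "'w measure \<Rightarrow> ('w \<Rightarrow> 'a::euclidean_space) \<Rightarrow> bool" where
  "sq_integrable M f \<longleftrightarrow> f \<in> borel_measurable M \<and> integrable M (\<lambda>\<omega>. (norm (f \<omega>))\<^sup>2)"

lemma sq_integrable_bound:
  fixes f :: "'w \<Rightarrow> 'a::euclidean_space"
  assumes "f \<in> borel_measurable M" "integrable M g" "\<And>\<omega>. \<omega> \<in> space M \<Longrightarrow> (norm (f \<omega>))\<^sup>2 \<le> g \<omega>"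
  shows "sq_integrable M f"
  unfolding sq_integrable_def
proof
  have [measurable]: "f \<in> borel_measurable M"
    by fact
  show "integrable M (\<lambda>\<omega>. (norm (f \<omega>))\<^sup>2)"
    by (rule Bochner_Integration.integrable_bound[OF assms(2)])
       (use assms(3) in \<open>auto intro!: AE_I2 order_trans[OF _ abs_ge_self]\<close>)
qed fact

lemma sq_integrable_add:
  assumes "sq_integrable M f" "sq_integrable M g"
  shows "sq_integrable M (\<lambda>\<omega>. f \<omega> + g \<omega>)"
  by (rule sq_integrable_bound[where g = "\<lambda>\<omega>. 2 * (norm (f \<omega>))\<^sup>2 + 2 * (norm (g \<omega>))\<^sup>2"])
     (use assms norm_add_squared_le in \<open>auto simp: sq_integrable_def\<close>)

lemma sq_integrable_scaleR:
  "sq_integrable M f \<Longrightarrow> sq_integrable M (\<lambda>\<omega>. c *\<^sub>R f \<omega>)"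
  by (auto simp: sq_integrable_def power_mult_distrib)

lemma sq_integrable_diff:
  assumes "sq_integrable M f" "sq_integrable M g"
  shows "sq_integrable M (\<lambda>\<omega>. f \<omega> - g \<omega>)"
  using sq_integrable_add[OF assms(1) sq_integrable_scaleR[OF assms(2), of "-1"]] by simp

lemma (in finite_measure) sq_integrable_const: "sq_integrable M (\<lambda>_. c)"
  by (simp add: sq_integrable_def)

lemma sq_integrable_cong:
  "(\<And>\<omega>. \<omega> \<in> space M \<Longrightarrow> f \<omega> = g \<omega>) \<Longrightarrow> sq_integrable M f \<longleftrightarrow> sq_integrable M g"
  unfolding sq_integrable_def
  by (intro conj_cong measurable_cong Bochner_Integration.integrable_cong) auto

lemma sq_integrable_inner:
  fixes f g :: "'w \<Rightarrow> 'a::euclidean_space"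
  assumes "sq_integrable M f" "sq_integrable M g"
  shows "integrable M (\<lambda>\<omega>. f \<omega> \<bullet> g \<omega>)"
proof (rule Bochner_Integration.integrable_bound)
  show "integrable M (\<lambda>\<omega>. (norm (f \<omega>))\<^sup>2 + (norm (g \<omega>))\<^sup>2)"
    using assms by (auto simp: sq_integrable_def)
  show "(\<lambda>\<omega>. f \<omega> \<bullet> g \<omega>) \<in> borel_measurable M"
    using assms by (auto simp: sq_integrable_def)
  have "\<bar>a \<bullet> b\<bar> \<le> (norm a)\<^sup>2 + (norm b)\<^sup>2" for a b :: 'a
  proof -
    have "\<bar>a \<bullet> b\<bar> \<le> norm a * norm b"
      by (rule Cauchy_Schwarz_ineq2)
    also have "\<dots> \<le> (norm a)\<^sup>2 + (norm b)\<^sup>2"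
      using sum_squares_bound[of "norm a" "norm b"] mult_nonneg_nonneg[OF norm_ge_zero[of a] norm_ge_zero[of b]]
      by linarith
    finally show ?thesis .
  qed
  then show "AE \<omega> in M. norm (f \<omega> \<bullet> g \<omega>) \<le> norm ((norm (f \<omega>))\<^sup>2 + (norm (g \<omega>))\<^sup>2)"
    by (intro AE_I2) simp
qed

section \<open>The random process and its filtration\<close>

locale past_es_process = prob_space M
  for M :: "'w measure" +
  fixes h :: "'a::euclidean_space \<Rightarrow> ereal" and F :: "'a \<Rightarrow> 'a" and Z :: "'a set"
    and z0 :: 'a and L D \<sigma> \<gamma> :: real and K :: nat
    and P :: "'s measure" and G :: "'a \<Rightarrow> 's \<Rightarrow> 'a"
    and \<xi> :: "nat \<Rightarrow> 'w \<Rightarrow> 's" and z zh :: "nat \<Rightarrow> 'w \<Rightarrow> 'a"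
  assumes h: "proper_fun h" "lsc_fun h" "convex_fun h"
    and edom_Z: "edom h \<subseteq> Z"
    and noise: "unbiased_sampling P G F (\<sigma>\<^sup>2)"
    and lipschitz: "boundedly_lipschitz_on Z F L D"
    and samples: "iid_samples M P \<xi>"
    and z0: "z0 \<in> Z"
    and \<gamma>: "\<gamma> > 0"
    and iterates: "\<And>\<omega>. \<omega> \<in> space M \<Longrightarrow>
      past_es \<gamma> h G (\<lambda>k. \<xi> k \<omega>) z0 K (\<lambda>k. z k \<omega>) (\<lambda>k. zh k \<omega>)"
begin

text \<open>The natural filtration of the samples. Generating it by one product-valued map gives it
  the form in which \<open>indep_var_restrict\<close> yields independence.\<close>

definition past :: "nat \<Rightarrow> 'w measure" where
  "past k = vimage_algebra (space M) (\<lambda>\<omega>. \<lambda>i\<in>{..<k}. \<xi> i \<omega>) (Pi\<^sub>M {..<k} (\<lambda>_. P))"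

lemma measurable_sample: "\<xi> k \<in> measurable M P"
  using samples by (auto simp: iid_samples_def indep_vars_def2)

lemma space_past: "space (past k) = space M"
  by (simp add: past_def)

lemma measurable_past_restrict:
  "(\<lambda>\<omega>. \<lambda>i\<in>{..<k}. \<xi> i \<omega>) \<in> measurable (past k) (Pi\<^sub>M {..<k} (\<lambda>_. P))"
  unfolding past_def
  by (rule measurable_vimage_algebra1)
     (use measurable_space[OF measurable_sample] in \<open>auto simp: space_PiM\<close>)

lemma measurable_past_sample:
  assumes "i < k"
  shows "\<xi> i \<in> measurable (past k) P"
proof -
  have "(\<lambda>\<omega>. (\<lambda>i\<in>{..<k}. \<xi> i \<omega>) i) \<in> measurable (past k) P"
    by (rule measurable_compose[OF measurable_past_restrict measurable_component_singleton])
       (use assms in auto)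
  then show ?thesis
    using assms by simp
qed

lemma subalgebra_past: "subalgebra M (past k)"
proof -
  have "(\<lambda>\<omega>. \<lambda>i\<in>{..<k}. \<xi> i \<omega>) \<in> measurable M (Pi\<^sub>M {..<k} (\<lambda>_. P))"
    by (intro measurable_restrict measurable_sample)
  then show ?thesis
    unfolding subalgebra_def past_def by (auto dest!: sets_image_in_sets[rotated])
qed

lemma subalgebra_past_mono:
  assumes "j \<le> k"
  shows "subalgebra (past k) (past j)"
proof -
  have "(\<lambda>\<omega>. \<lambda>i\<in>{..<j}. \<xi> i \<omega>) \<in> measurable (past k) (Pi\<^sub>M {..<j} (\<lambda>_. P))"
    using assms by (intro measurable_restrict measurable_past_sample) auto
  from sets_image_in_sets[OF _ this, of "space M"] show ?thesis
    unfolding subalgebra_def by (simp add: past_def space_past[unfolded past_def])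
qed

lemmas measurable_past_le = measurable_from_subalg[OF subalgebra_past_mono]
lemmas measurable_past_imp = measurable_from_subalg[OF subalgebra_past]

lemma prob_space_P: "prob_space P"
  using noise by (simp add: unbiased_sampling_def)

text \<open>The index blocks \<open>{..<k}\<close> and \<open>{k}\<close> are disjoint, so the
  restricted families are independent. What remains is to identify \<open>\<xi> k\<close> with the
  family over the one-element block.\<close>

lemma prob_past_sample:
  assumes A: "A \<in> sets (past k)" and B: "B \<in> sets P"
  shows "prob (A \<inter> (\<xi> k -` B \<inter> space M)) = prob A * prob (\<xi> k -` B \<inter> space M)"
proof -
  let ?R = "\<lambda>A \<omega>. \<lambda>i\<in>A. \<xi> i \<omega>" and ?N = "\<lambda>A. Pi\<^sub>M A (\<lambda>_. P)"
  have "indep_var (?N {..<k}) (?R {..<k}) (?N {k}) (?R {k})"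
    using samples by (intro indep_var_restrict[where I = UNIV]) (auto simp: iid_samples_def)
  then have indep: "indep_set (sets (past k))
      (sigma_sets (space M) {?R {k} -` E \<inter> space M | E. E \<in> sets (?N {k})})"
    unfolding indep_var_eq past_def sets_vimage_algebra by simp
  have "(\<lambda>f. f k) \<in> measurable (?N {k}) P"
    by (rule measurable_component_singleton) simp
  from measurable_sets[OF this B] have E: "(\<lambda>f. f k) -` B \<inter> space (?N {k}) \<in> sets (?N {k})" .
  have "\<xi> k -` B \<inter> space M = ?R {k} -` ((\<lambda>f. f k) -` B \<inter> space (?N {k})) \<inter> space M"
    using measurable_space[OF measurable_sample] by (auto simp: space_PiM)
  then have "\<xi> k -` B \<inter> space M \<in> sigma_sets (space M) {?R {k} -` E \<inter> space M | E. E \<in> sets (?N {k})}"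
    using E by (blast intro: sigma_sets.Basic)
  then show ?thesis
    by (rule indep_setD[OF indep A])
qed

text \<open>The substitute for conditioning on the past: under a product law the fresh sample can be
  integrated out with the value of \<open>v\<close> held fixed. The two measures are compared on
  rectangles.\<close>

lemma distr_past_sample:
  assumes v: "v \<in> measurable (past k) N"
  shows "distr M (N \<Otimes>\<^sub>M P) (\<lambda>\<omega>. (v \<omega>, \<xi> k \<omega>)) = distr M N v \<Otimes>\<^sub>M P"
proof -
  have vM: "v \<in> measurable M N"
    by (rule measurable_past_imp[OF v])
  have X: "(\<lambda>\<omega>. (v \<omega>, \<xi> k \<omega>)) \<in> measurable M (N \<Otimes>\<^sub>M P)"
    by (intro measurable_Pair vM measurable_sample)
  interpret P: prob_space P
    by (rule prob_space_P)
  interpret D: prob_space "distr M N v"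
    by (rule prob_space_distr[OF vM])
  have distr_P: "distr M P (\<xi> k) = P"
    using samples by (auto simp: iid_samples_def)
  show ?thesis
  proof (rule pair_measure_eqI[symmetric])
    fix A B assume "A \<in> sets (distr M N v)" and B: "B \<in> sets P"
    then have A: "A \<in> sets N"
      by simp
    have "v -` A \<inter> space M \<in> sets (past k)"
      using measurable_sets[OF v A] by (simp add: space_past)
    from prob_past_sample[OF this B]
    have "emeasure M ((v -` A \<inter> space M) \<inter> (\<xi> k -` B \<inter> space M))
        = emeasure M (v -` A \<inter> space M) * emeasure M (\<xi> k -` B \<inter> space M)"
      by (simp add: emeasure_eq_measure ennreal_mult)
    moreover have "emeasure P B = emeasure M (\<xi> k -` B \<inter> space M)"
      using B by (subst distr_P[symmetric]) (simp add: emeasure_distr[OF measurable_sample])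
    moreover have "(\<lambda>\<omega>. (v \<omega>, \<xi> k \<omega>)) -` (A \<times> B) \<inter> space M
        = (v -` A \<inter> space M) \<inter> (\<xi> k -` B \<inter> space M)"
      by auto
    ultimately show "emeasure (distr M N v) A * emeasure P B
        = emeasure (distr M (N \<Otimes>\<^sub>M P) (\<lambda>\<omega>. (v \<omega>, \<xi> k \<omega>))) (A \<times> B)"
      using A B by (simp add: emeasure_distr[OF vM] emeasure_distr[OF X])
  qed (auto intro: D.sigma_finite_measure_axioms P.sigma_finite_measure_axioms cong: sets_pair_measure_cong)
qed

lemma measurable_G: "(\<lambda>(x, s). G x s) \<in> borel_measurable (borel \<Otimes>\<^sub>M P)"
  using noise by (simp add: unbiased_sampling_def)

lemma measurable_F [measurable]: "F \<in> borel_measurable borel"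
proof -
  interpret P: prob_space P
    by (rule prob_space_P)
  have "(\<lambda>x. \<integral>s. G x s \<partial>P) \<in> borel_measurable borel"
    by (rule P.borel_measurable_lebesgue_integral[OF measurable_G])
  also have "(\<lambda>x. \<integral>s. G x s \<partial>P) = F"
    using noise by (auto simp: unbiased_sampling_def)
  finally show ?thesis .
qed

lemma measurable_G_compose:
  assumes "v \<in> borel_measurable N" "s \<in> measurable N P"
  shows "(\<lambda>\<omega>. G (v \<omega>) (s \<omega>)) \<in> borel_measurable N"
  using measurable_compose[OF measurable_Pair[OF assms] measurable_G] by simp

text \<open>By Tonelli the inner integral over the sample is bounded by the variance at each frozen
  point. Nonnegative integrals are used because integrability is itself part of the claim.\<close>

lemma noise_second_moment:
  assumes v: "v \<in> borel_measurable (past k)"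
  shows "sq_integrable M (\<lambda>\<omega>. G (v \<omega>) (\<xi> k \<omega>) - F (v \<omega>))"
    and "(\<integral>\<omega>. (norm (G (v \<omega>) (\<xi> k \<omega>) - F (v \<omega>)))\<^sup>2 \<partial>M) \<le> \<sigma>\<^sup>2"
proof -
  interpret P: prob_space P
    by (rule prob_space_P)
  note [measurable] = measurable_past_imp[OF v] measurable_sample measurable_G
  interpret D: prob_space "distr M borel v"
    by (rule prob_space_distr) simp
  let ?err = "\<lambda>\<omega>. G (v \<omega>) (\<xi> k \<omega>) - F (v \<omega>)"
  have err [measurable]: "?err \<in> borel_measurable M"
    using measurable_G_compose[OF measurable_past_imp[OF v] measurable_sample] by simp
  have f: "(\<lambda>(x, s). ennreal ((norm (G x s - F x))\<^sup>2)) \<in> borel_measurable (borel \<Otimes>\<^sub>M P)"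
    by measurable
  have "(\<integral>\<^sup>+\<omega>. ennreal ((norm (?err \<omega>))\<^sup>2) \<partial>M)
      = (\<integral>\<^sup>+p. (\<lambda>(x, s). ennreal ((norm (G x s - F x))\<^sup>2)) p \<partial>distr M (borel \<Otimes>\<^sub>M P) (\<lambda>\<omega>. (v \<omega>, \<xi> k \<omega>)))"
    using f by (subst nn_integral_distr) auto
  also have "\<dots> = (\<integral>\<^sup>+p. (\<lambda>(x, s). ennreal ((norm (G x s - F x))\<^sup>2)) p \<partial>(distr M borel v \<Otimes>\<^sub>M P))"
    by (simp only: distr_past_sample[OF v])
  also have "\<dots> = (\<integral>\<^sup>+x. \<integral>\<^sup>+s. ennreal ((norm (G x s - F x))\<^sup>2) \<partial>P \<partial>distr M borel v)"
    using f by (subst P.nn_integral_fst[symmetric]) (auto simp: split_beta')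
  also have "\<dots> \<le> (\<integral>\<^sup>+x. ennreal (\<sigma>\<^sup>2) \<partial>distr M borel v)"
  proof (intro nn_integral_mono)
    fix x
    have "integrable P (\<lambda>s. (norm (G x s - F x))\<^sup>2)" "(\<integral>s. (norm (G x s - F x))\<^sup>2 \<partial>P) \<le> \<sigma>\<^sup>2"
      using noise by (auto simp: unbiased_sampling_def)
    then show "(\<integral>\<^sup>+s. ennreal ((norm (G x s - F x))\<^sup>2) \<partial>P) \<le> ennreal (\<sigma>\<^sup>2)"
      by (subst nn_integral_eq_integral) (auto intro: ennreal_leI)
  qed
  also have "\<dots> = ennreal (\<sigma>\<^sup>2)"
    using D.emeasure_space_1 by simp
  finally have le: "(\<integral>\<^sup>+\<omega>. ennreal ((norm (?err \<omega>))\<^sup>2) \<partial>M) \<le> ennreal (\<sigma>\<^sup>2)" .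
  then have int: "integrable M (\<lambda>\<omega>. (norm (?err \<omega>))\<^sup>2)"
    by (intro integrableI_bounded) (auto simp: le_less_trans)
  then show "sq_integrable M ?err"
    by (simp add: sq_integrable_def)
  show "(\<integral>\<omega>. (norm (?err \<omega>))\<^sup>2 \<partial>M) \<le> \<sigma>\<^sup>2"
    using le by (subst (asm) nn_integral_eq_integral[OF int]) (auto simp: ennreal_le_iff)
qed

text \<open>The pair of \<open>v\<close> and \<open>u\<close> is determined by the past, so for
  frozen values the inner integral vanishes by unbiasedness. Square integrability of both factors
  justifies Fubini.\<close>

lemma noise_orthogonal:
  assumes v: "v \<in> borel_measurable (past k)" and u: "u \<in> borel_measurable (past k)" "sq_integrable M u"
  shows "(\<integral>\<omega>. (G (v \<omega>) (\<xi> k \<omega>) - F (v \<omega>)) \<bullet> u \<omega> \<partial>M) = 0"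
proof -
  interpret P: prob_space P
    by (rule prob_space_P)
  note [measurable] = measurable_past_imp[OF v] measurable_past_imp[OF u(1)] measurable_sample measurable_G
  let ?w = "\<lambda>\<omega>. (v \<omega>, u \<omega>)"
  have w: "?w \<in> measurable (past k) (borel \<Otimes>\<^sub>M borel)"
    using v u by simp
  then have wM [measurable]: "?w \<in> measurable M (borel \<Otimes>\<^sub>M borel)"
    by (rule measurable_past_imp)
  let ?D = "distr M (borel \<Otimes>\<^sub>M borel) ?w"
  interpret D: prob_space ?D
    by (rule prob_space_distr) simp
  interpret PD: pair_sigma_finite ?D P ..
  let ?f = "\<lambda>((x, y), s). (G x s - F x) \<bullet> y"
  let ?X = "\<lambda>\<omega>. (?w \<omega>, \<xi> k \<omega>)"
  have "(\<lambda>p. (fst (fst p), snd p)) \<in> measurable ((borel \<Otimes>\<^sub>M borel) \<Otimes>\<^sub>M P) (borel \<Otimes>\<^sub>M P)"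
    by measurable
  from measurable_compose[OF this measurable_G]
  have G': "(\<lambda>p. G (fst (fst p)) (snd p)) \<in> borel_measurable (((borel :: 'a measure) \<Otimes>\<^sub>M (borel :: 'a measure)) \<Otimes>\<^sub>M P)"
    by simp
  have f: "?f \<in> borel_measurable ((borel \<Otimes>\<^sub>M borel) \<Otimes>\<^sub>M P)"
    unfolding split_beta' using G' by measurable
  have X: "?X \<in> measurable M ((borel \<Otimes>\<^sub>M borel) \<Otimes>\<^sub>M P)"
    by measurable
  have "integrable M (\<lambda>\<omega>. (G (v \<omega>) (\<xi> k \<omega>) - F (v \<omega>)) \<bullet> u \<omega>)"
    by (intro sq_integrable_inner noise_second_moment(1) v u)
  then have "integrable (distr M ((borel \<Otimes>\<^sub>M borel) \<Otimes>\<^sub>M P) ?X) ?f"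
    using f X by (subst integrable_distr_eq) auto
  then have int: "integrable (?D \<Otimes>\<^sub>M P) ?f"
    by (simp only: distr_past_sample[OF w])
  have "(\<integral>\<omega>. (G (v \<omega>) (\<xi> k \<omega>) - F (v \<omega>)) \<bullet> u \<omega> \<partial>M)
      = (\<integral>p. ?f p \<partial>distr M ((borel \<Otimes>\<^sub>M borel) \<Otimes>\<^sub>M P) ?X)"
    using f X by (subst integral_distr) auto
  also have "\<dots> = (\<integral>p. ?f p \<partial>(?D \<Otimes>\<^sub>M P))"
    by (simp only: distr_past_sample[OF w])
  also have "\<dots> = (\<integral>q. (\<integral>s. ?f (q, s) \<partial>P) \<partial>?D)"
    by (rule PD.integral_fst'[OF int, symmetric])
  also have "\<dots> = (\<integral>q. 0 \<partial>?D)"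
  proof (intro Bochner_Integration.integral_cong refl)
    fix q :: "'a \<times> 'a"
    have "integrable P (G (fst q))" "F (fst q) = (\<integral>s. G (fst q) s \<partial>P)"
      using noise by (auto simp: unbiased_sampling_def)
    then show "(\<integral>s. ?f (q, s) \<partial>P) = 0"
      by (simp add: split_beta' P.prob_space)
  qed
  finally show ?thesis
    by simp
qed

section \<open>Measurability and integrability of the iterates\<close>

lemma sq_integrable_F:
  assumes v: "sq_integrable M v" "\<And>\<omega>. \<omega> \<in> space M \<Longrightarrow> v \<omega> \<in> Z"
  shows "sq_integrable M (\<lambda>\<omega>. F (v \<omega>))"
proof (rule sq_integrable_bound)
  have [measurable]: "v \<in> borel_measurable M"
    using v by (simp add: sq_integrable_def)
  show "(\<lambda>\<omega>. F (v \<omega>)) \<in> borel_measurable M"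
    by simp
  \<comment> \<open>The bounded Lipschitz condition, taken against the fixed point
    \<open>z0\<close>, limits \<open>F\<close> to linear growth on \<open>Z\<close>.\<close>
  show "integrable M (\<lambda>\<omega>. 2 * (L\<^sup>2 * (norm (v \<omega> - z0))\<^sup>2 + D\<^sup>2) + 2 * (norm (F z0))\<^sup>2)"
    using sq_integrable_diff[OF v(1) sq_integrable_const[of z0]] by (simp add: sq_integrable_def)
  fix \<omega> assume "\<omega> \<in> space M"
  then have "(norm (F (v \<omega>) - F z0))\<^sup>2 \<le> L\<^sup>2 * (norm (v \<omega> - z0))\<^sup>2 + D\<^sup>2"
    using lipschitz v z0 by (simp add: boundedly_lipschitz_on_def)
  then show "(norm (F (v \<omega>)))\<^sup>2 \<le> 2 * (L\<^sup>2 * (norm (v \<omega> - z0))\<^sup>2 + D\<^sup>2) + 2 * (norm (F z0))\<^sup>2"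
    using norm_add_squared_le[of "F (v \<omega>) - F z0" "F z0"] by simp
qed

lemma measurable_prox [measurable]: "prox \<gamma> h \<in> borel_measurable borel"
  by (intro borel_measurable_continuous_onI continuous_on_prox h \<gamma>)

lemma sq_integrable_prox:
  assumes w: "sq_integrable M w"
  shows "sq_integrable M (\<lambda>\<omega>. prox \<gamma> h (w \<omega>))"
proof (rule sq_integrable_bound)
  have [measurable]: "w \<in> borel_measurable M"
    using w by (simp add: sq_integrable_def)
  show "(\<lambda>\<omega>. prox \<gamma> h (w \<omega>)) \<in> borel_measurable M"
    by simp
  show "integrable M (\<lambda>\<omega>. 2 * (norm (w \<omega>))\<^sup>2 + 2 * (norm (prox \<gamma> h 0))\<^sup>2)"
    using w by (simp add: sq_integrable_def)
  fix \<omega>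
  have "norm (prox \<gamma> h (w \<omega>) - prox \<gamma> h 0) \<le> norm (w \<omega>)"
    using prox_nonexpansive[OF h \<gamma>, of "w \<omega>" 0] by simp
  then have "(norm (prox \<gamma> h (w \<omega>) - prox \<gamma> h 0))\<^sup>2 \<le> (norm (w \<omega>))\<^sup>2"
    by (intro power_mono) auto
  then show "(norm (prox \<gamma> h (w \<omega>)))\<^sup>2 \<le> 2 * (norm (w \<omega>))\<^sup>2 + 2 * (norm (prox \<gamma> h 0))\<^sup>2"
    using norm_add_squared_le[of "prox \<gamma> h (w \<omega>) - prox \<gamma> h 0" "prox \<gamma> h 0"]
    unfolding diff_add_cancel by linarith
qed

lemma z_0: "\<omega> \<in> space M \<Longrightarrow> z 0 \<omega> = z0"
  and zh_0: "\<omega> \<in> space M \<Longrightarrow> zh 0 \<omega> = z0"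
  and zh_Suc: "\<omega> \<in> space M \<Longrightarrow> k < K \<Longrightarrow>
    zh (Suc k) \<omega> = prox \<gamma> h (z k \<omega> - \<gamma> *\<^sub>R G (zh k \<omega>) (\<xi> k \<omega>))"
  and z_Suc: "\<omega> \<in> space M \<Longrightarrow> k < K \<Longrightarrow>
    z (Suc k) \<omega> = prox \<gamma> h (z k \<omega> - \<gamma> *\<^sub>R G (zh (Suc k) \<omega>) (\<xi> (Suc k) \<omega>))"
  using iterates[of \<omega>] by (auto simp: past_es_def)

text \<open>The index starts at \<open>Suc k\<close>: the starting point is only known to lie in
  \<open>Z\<close>, and \<open>h\<close> may be infinite there.\<close>

lemma zh_in_edom: "\<omega> \<in> space M \<Longrightarrow> k < K \<Longrightarrow> zh (Suc k) \<omega> \<in> edom h"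
  by (simp add: zh_Suc prox_in_edom[OF h \<gamma>])

lemma zh_in_Z: "\<omega> \<in> space M \<Longrightarrow> k \<le> K \<Longrightarrow> zh k \<omega> \<in> Z"
  using zh_in_edom edom_Z z0 zh_0 by (cases k) (auto simp: Suc_le_eq)

lemma sq_integrable_oracle:
  assumes "v \<in> borel_measurable (past k)" "sq_integrable M v" "\<And>\<omega>. \<omega> \<in> space M \<Longrightarrow> v \<omega> \<in> Z"
  shows "sq_integrable M (\<lambda>\<omega>. G (v \<omega>) (\<xi> k \<omega>))"
  using sq_integrable_add[OF noise_second_moment(1)[OF assms(1)] sq_integrable_F[OF assms(2,3)]] by simp

text \<open>The two sequences differ by one in the filtration: \<open>z k\<close> has already used
  sample \<open>k\<close>, while \<open>zh k\<close> has not, so \<open>\<xi> k\<close> is fresh for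
  the oracle call at \<open>zh k\<close>. Both properties go through one induction because square
  integrability of the oracle value needs measurability with respect to the past.\<close>

lemma iterates_regular:
  assumes "k \<le> K"
  shows "zh k \<in> borel_measurable (past k) \<and> sq_integrable M (zh k) \<and>
    z k \<in> borel_measurable (past (Suc k)) \<and> sq_integrable M (z k)"
  using assms
proof (induction k)
  case 0
  have "zh 0 \<in> borel_measurable (past 0)" "z 0 \<in> borel_measurable (past (Suc 0))"
    using measurable_cong[of "past 0" "zh 0" "\<lambda>_. z0"] zh_0
      measurable_cong[of "past (Suc 0)" "z 0" "\<lambda>_. z0"] z_0 by (simp_all add: space_past)
  moreover have "sq_integrable M (zh 0)" "sq_integrable M (z 0)"
    using sq_integrable_cong[of M "zh 0" "\<lambda>_. z0"] sq_integrable_cong[of M "z 0" "\<lambda>_. z0"]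
      zh_0 z_0 sq_integrable_const[of z0] by simp_all
  ultimately show ?case
    by simp
next
  case (Suc k)
  then have k: "k < K" "k \<le> K"
    by auto
  have IH: "zh k \<in> borel_measurable (past k)" "sq_integrable M (zh k)"
    "z k \<in> borel_measurable (past (Suc k))" "sq_integrable M (z k)"
    using Suc.IH k by auto
  \<comment> \<open>Serves both updates, with \<open>i\<close> the sample used and \<open>j\<close>
    the stage at which the result is known.\<close>
  have prox_meas: "(\<lambda>\<omega>. prox \<gamma> h (z k \<omega> - \<gamma> *\<^sub>R G (v \<omega>) (\<xi> i \<omega>))) \<in> borel_measurable (past j)"
    if "v \<in> borel_measurable (past j)" "i < j" "Suc k \<le> j" for v i j
  proof -
    have [measurable]: "(\<lambda>\<omega>. G (v \<omega>) (\<xi> i \<omega>)) \<in> borel_measurable (past j)"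
      using that by (intro measurable_G_compose measurable_past_sample)
    have [measurable]: "z k \<in> borel_measurable (past j)"
      by (rule measurable_past_le[OF that(3) IH(3)])
    show ?thesis
      by measurable
  qed
  have "zh (Suc k) \<in> borel_measurable (past (Suc k)) \<longleftrightarrow>
      (\<lambda>\<omega>. prox \<gamma> h (z k \<omega> - \<gamma> *\<^sub>R G (zh k \<omega>) (\<xi> k \<omega>))) \<in> borel_measurable (past (Suc k))"
    using zh_Suc[OF _ k(1)] by (intro measurable_cong) (simp add: space_past)
  then have 1: "zh (Suc k) \<in> borel_measurable (past (Suc k))"
    using prox_meas[OF measurable_past_le[OF _ IH(1)], of "Suc k" k] by simp
  have "z (Suc k) \<in> borel_measurable (past (Suc (Suc k))) \<longleftrightarrow>
      (\<lambda>\<omega>. prox \<gamma> h (z k \<omega> - \<gamma> *\<^sub>R G (zh (Suc k) \<omega>) (\<xi> (Suc k) \<omega>))) \<in> borel_measurable (past (Suc (Suc k)))"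
    using z_Suc[OF _ k(1)] by (intro measurable_cong) (simp add: space_past)
  then have 2: "z (Suc k) \<in> borel_measurable (past (Suc (Suc k)))"
    using prox_meas[OF measurable_past_le[OF _ 1], of "Suc (Suc k)" "Suc k"] by simp
  have "sq_integrable M (zh (Suc k)) \<longleftrightarrow>
      sq_integrable M (\<lambda>\<omega>. prox \<gamma> h (z k \<omega> - \<gamma> *\<^sub>R G (zh k \<omega>) (\<xi> k \<omega>)))"
    by (rule sq_integrable_cong) (rule zh_Suc[OF _ k(1)])
  then have 3: "sq_integrable M (zh (Suc k))"
    using sq_integrable_prox[OF sq_integrable_diff[OF IH(4) sq_integrable_scaleR[OF sq_integrable_oracle[OF IH(1,2)]]]]
      zh_in_Z[OF _ k(2)] by simp
  have "sq_integrable M (z (Suc k)) \<longleftrightarrow>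
      sq_integrable M (\<lambda>\<omega>. prox \<gamma> h (z k \<omega> - \<gamma> *\<^sub>R G (zh (Suc k) \<omega>) (\<xi> (Suc k) \<omega>)))"
    by (rule sq_integrable_cong) (rule z_Suc[OF _ k(1)])
  then have 4: "sq_integrable M (z (Suc k))"
    using sq_integrable_prox[OF sq_integrable_diff[OF IH(4) sq_integrable_scaleR[OF sq_integrable_oracle[OF 1 3]]]]
      zh_in_Z[OF _ Suc.prems] by simp
  from 1 2 3 4 show ?case
    by simp
qed

lemmas zh_measurable = iterates_regular[THEN conjunct1]
lemmas zh_sq_integrable = iterates_regular[THEN conjunct2, THEN conjunct1]
lemmas z_sq_integrable = iterates_regular[THEN conjunct2, THEN conjunct2, THEN conjunct2]

definition err :: "nat \<Rightarrow> 'w \<Rightarrow> 'a" where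
  "err k \<omega> = G (zh k \<omega>) (\<xi> k \<omega>) - F (zh k \<omega>)"

lemma err_sq_integrable: "k \<le> K \<Longrightarrow> sq_integrable M (err k)"
  and err_second_moment: "k \<le> K \<Longrightarrow> (\<integral>\<omega>. (norm (err k \<omega>))\<^sup>2 \<partial>M) \<le> \<sigma>\<^sup>2"
  and err_orthogonal: "k \<le> K \<Longrightarrow> u \<in> borel_measurable (past k) \<Longrightarrow> sq_integrable M u \<Longrightarrow>
    (\<integral>\<omega>. err k \<omega> \<bullet> u \<omega> \<partial>M) = 0"
  unfolding err_def[abs_def]
  by (auto intro!: noise_second_moment noise_orthogonal zh_measurable)

lemma err_measurable: "k \<le> K \<Longrightarrow> k < j \<Longrightarrow> err k \<in> borel_measurable (past j)"
proof -
  assume k: "k \<le> K" "k < j"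
  have [measurable]: "zh k \<in> borel_measurable (past j)"
    using k by (intro measurable_past_le[OF _ zh_measurable]) auto
  have [measurable]: "(\<lambda>\<omega>. G (zh k \<omega>) (\<xi> k \<omega>)) \<in> borel_measurable (past j)"
    using k by (intro measurable_G_compose measurable_past_sample) auto
  show ?thesis
    unfolding err_def[abs_def] by measurable
qed

lemma iterates_step:
  assumes step: "288 * (\<gamma>\<^sup>2 * L\<^sup>2) \<le> 1" and k: "k < K" and \<omega>: "\<omega> \<in> space M" and u: "u \<in> edom h"
  shows "(norm (z (Suc k) \<omega> - u))\<^sup>2 + 1/2 * (norm (z (Suc k) \<omega> - zh (Suc k) \<omega>))\<^sup>2
      + 2 * \<gamma> * ((F (zh (Suc k) \<omega>) + err (Suc k) \<omega>) \<bullet> (zh (Suc k) \<omega> - u)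
          + real_of_ereal (h (zh (Suc k) \<omega>)) - real_of_ereal (h u))
    \<le> (norm (z k \<omega> - u))\<^sup>2 + 1/24 * (norm (z k \<omega> - zh k \<omega>))\<^sup>2
      - 23/24 * (norm (z k \<omega> - zh (Suc k) \<omega>))\<^sup>2
      + 6 * \<gamma>\<^sup>2 * ((norm (err (Suc k) \<omega>))\<^sup>2 + (norm (err k \<omega>))\<^sup>2 + D\<^sup>2)"
  using past_es_step[OF h \<gamma> lipschitz step _ _ u zh_Suc[OF \<omega> k] z_Suc[OF \<omega> k]]
    zh_in_Z[OF \<omega>, of k] zh_in_Z[OF \<omega>, of "Suc k"] k
  by (simp add: err_def)

end

section \<open>Expected bounds\<close>

text \<open>\<open>c / (1 - q)\<close> is the fixed point of \<open>t \<mapsto> q * t + c\<close>,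
  so it reproduces itself as the additive term.\<close>

lemma affine_recursion_bound:
  fixes a :: "nat \<Rightarrow> real"
  assumes rec: "\<And>k. k < n \<Longrightarrow> a (Suc k) \<le> q * a k + c" and q: "0 \<le> q" "q < 1" and c: "0 \<le> c"
    and k: "k \<le> n"
  shows "a k \<le> q ^ k * a 0 + c / (1 - q)"
  using k
proof (induction k)
  case (Suc k)
  then have "a (Suc k) \<le> q * a k + c"
    by (intro rec) simp
  also have "\<dots> \<le> q * (q ^ k * a 0 + c / (1 - q)) + c"
    using Suc q by (intro add_mono mult_left_mono) auto
  also have "\<dots> = q ^ Suc k * a 0 + c / (1 - q)"
    using q by (simp add: field_simps)
  finally show ?case .
qed (use q c in auto)

section \<open>Properties of the solution\<close>

lemma vi_solution_edom:
  assumes h: "proper_fun h" "edom h \<subseteq> Z" and zs: "vi_solution Z F h zs"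
  shows "zs \<in> edom h"
proof -
  obtain x where "h x \<noteq> \<infinity>" "h x \<noteq> -\<infinity>"
    using h by (auto simp: proper_fun_def)
  then obtain r where r: "h x = ereal r"
    by (cases "h x") auto
  then have "x \<in> Z"
    using h by (auto simp: edom_def)
  then have "ereal (F zs \<bullet> (x - zs)) + h x - h zs \<ge> 0"
    using zs by (simp add: vi_solution_def)
  \<comment> \<open>With \<open>h x\<close> finite, an infinite \<open>h zs\<close> would make the
    left side -\<infinity>.\<close>
  then show ?thesis
    by (cases "h zs") (auto simp: r edom_def)
qed

text \<open>The variational inequality rearranges to the subgradient inequality on
  \<open>edom h\<close>; elsewhere \<open>h\<close> is infinite, so it holds globally as
  \<open>subdiff\<close> demands.\<close>

lemma vi_solution_subdiff:
  assumes h: "proper_fun h" "edom h \<subseteq> Z" and zs: "vi_solution Z F h zs"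
  shows "- F zs \<in> subdiff h zs"
proof -
  obtain s where s: "h zs = ereal s"
    using edom_real[OF h(1) vi_solution_edom[OF h zs]] by blast
  have "h y \<ge> h zs + ereal (- F zs \<bullet> (y - zs))" for y
  proof (cases "y \<in> edom h")
    case True
    then obtain r where r: "h y = ereal r"
      using edom_real[OF h(1)] by blast
    have "ereal (F zs \<bullet> (y - zs)) + h y - h zs \<ge> 0"
      using zs True h by (auto simp: vi_solution_def)
    then show ?thesis
      by (simp add: r s)
  qed (simp add: edom_def)
  then show ?thesis
    by (simp add: subdiff_def)
qed

text \<open>Strong convexity is applied at \<open>zs\<close> with the particular subgradient
  \<open>- F zs\<close>.\<close>

lemma vi_solution_quadratic_growth:
  assumes h: "proper_fun h" "edom h \<subseteq> Z" and zs: "vi_solution Z F h zs"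
    and sc: "strongly_convex_fun_on Z h \<mu>" and y: "y \<in> edom h"
  shows "\<mu> / 2 * (norm (y - zs))\<^sup>2 \<le> F zs \<bullet> (y - zs) + real_of_ereal (h y) - real_of_ereal (h zs)"
proof -
  obtain s where s: "h zs = ereal s"
    using edom_real[OF h(1) vi_solution_edom[OF h zs]] by blast
  obtain r where r: "h y = ereal r"
    using edom_real[OF h(1) y] by blast
  have "h y - h zs - ereal (- F zs \<bullet> (y - zs)) \<ge> ereal (\<mu> / 2 * (norm (y - zs))\<^sup>2)"
    using sc vi_solution_subdiff[OF h zs] y h(2) vi_solution_edom[OF h zs]
    unfolding strongly_convex_fun_on_def by blast
  then show ?thesis
    by (simp add: r s)
qed

lemma borel_measurable_lsc_fun:
  fixes h :: "'a::topological_space \<Rightarrow> ereal"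
  assumes "lsc_fun h"
  shows "h \<in> borel_measurable borel"
  using lsc_fun_open_greater[OF assms] by (intro borel_measurableI_greater) simp

text \<open>Terms with \<open>h u\<close> infinite equal -\<infinity> and do not affect the
  supremum. The remaining terms are real and affine in \<open>x\<close> and \<open>h x\<close>, the
  form needed for measurability.\<close>

lemma Gap_eq_SUP_edom:
  assumes h: "proper_fun h" and x: "x \<in> edom h"
  shows "Gap F h C x = (SUP u\<in>C \<inter> edom h. ereal (F u \<bullet> (x - u) - real_of_ereal (h u) + real_of_ereal (h x)))"
proof (rule antisym)
  obtain r where r: "h x = ereal r"
    using edom_real[OF h x] by blast
  have term_eq: "ereal (F u \<bullet> (x - u) - real_of_ereal (h u) + real_of_ereal (h x))
      = ereal (F u \<bullet> (x - u)) + h x - h u" if u: "u \<in> edom h" for u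
  proof -
    obtain s where "h u = ereal s"
      using edom_real[OF h u] by blast
    then show ?thesis
      by (simp add: r)
  qed
  show "Gap F h C x \<le> (SUP u\<in>C \<inter> edom h. ereal (F u \<bullet> (x - u) - real_of_ereal (h u) + real_of_ereal (h x)))"
    unfolding Gap_def
  proof (rule SUP_least)
    fix u assume "u \<in> C"
    show "ereal (F u \<bullet> (x - u)) + h x - h u
      \<le> (SUP u\<in>C \<inter> edom h. ereal (F u \<bullet> (x - u) - real_of_ereal (h u) + real_of_ereal (h x)))"
    proof (cases "u \<in> edom h")
      case True
      then show ?thesis
        using \<open>u \<in> C\<close> by (subst term_eq[symmetric]) (auto intro: SUP_upper)
    qed (simp add: edom_def r)
  qed
  show "(SUP u\<in>C \<inter> edom h. ereal (F u \<bullet> (x - u) - real_of_ereal (h u) + real_of_ereal (h x))) \<le> Gap F h C x"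
    unfolding Gap_def using term_eq by (intro SUP_mono) auto
qed

text \<open>
  The supremum ranges over an uncountable set and \<open>F\<close> need not be continuous. But for a real variable
  \<open>t\<close> in place of \<open>h x\<close>, it is a supremum of functions that are continuous in \<open>(x, t)\<close>, hence
  lower semicontinuous.
\<close>

lemma borel_measurable_Gap:
  fixes h :: "'a::euclidean_space \<Rightarrow> ereal"
  assumes h: "proper_fun h" "lsc_fun h"
    and v: "v \<in> borel_measurable M" "\<And>\<omega>. \<omega> \<in> space M \<Longrightarrow> v \<omega> \<in> edom h"
  shows "(\<lambda>\<omega>. Gap F h C (v \<omega>)) \<in> borel_measurable M"
proof -
  let ?T = "\<lambda>p. SUP u\<in>C \<inter> edom h. ereal (F u \<bullet> (fst p - u) - real_of_ereal (h u) + snd p)"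
  have "?T \<in> borel_measurable borel"
  proof (rule borel_measurableI_greater)
    fix c :: ereal
    have "{p. c < ?T p} = (\<Union>u\<in>C \<inter> edom h. {p. c < ereal (F u \<bullet> (fst p - u) - real_of_ereal (h u) + snd p)})"
      by (auto simp: less_SUP_iff)
    moreover have "open {p. c < ereal (F u \<bullet> (fst p - u) - real_of_ereal (h u) + snd p)}" for u
      by (intro open_Collect_less continuous_intros)
    ultimately have "open {p. c < ?T p}"
      by auto
    then show "{p \<in> space borel. c < ?T p} \<in> sets borel"
      by simp
  qed
  moreover have "(\<lambda>\<omega>. (v \<omega>, real_of_ereal (h (v \<omega>)))) \<in> borel_measurable M"
    using measurable_compose[OF v(1) borel_measurable_lsc_fun[OF h(2)]] v(1)
    by (intro borel_measurable_Pair borel_measurable_real_of_ereal)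
  ultimately have "(\<lambda>\<omega>. ?T (v \<omega>, real_of_ereal (h (v \<omega>)))) \<in> borel_measurable M"
    by (rule measurable_compose[rotated])
  then show ?thesis
    using v(2) by (subst measurable_cong[OF Gap_eq_SUP_edom[OF h(1)]]) auto
qed

section \<open>Strongly monotone case\<close>

context past_es_process
begin

text \<open>Put m = \<gamma>(\<mu>F + \<mu>h). Strong monotonicity and quadratic growth give a
  decrease of m |y' - zs|^2. Half of m |x - zs|^2 is at most m |y' - zs|^2 + m |x - y'|^2, and since
  m \<le> 1/4 the last term fits into 23/24 |x - y'|^2. Likewise 1/24 is below (1 - m/2)/2, so the
  second part of the Lyapunov function contracts at the same rate.\<close>

lemma strongly_monotone_step:
  assumes step: "288 * (\<gamma>\<^sup>2 * L\<^sup>2) \<le> 1" and zs: "vi_solution Z F h zs"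
    and \<mu>: "\<mu>F \<ge> 0" "\<mu>h \<ge> 0" "4 * (\<gamma> * (\<mu>F + \<mu>h)) \<le> 1"
    and sm: "strongly_monotone_on Z F \<mu>F" and sc: "strongly_convex_fun_on Z h \<mu>h"
    and k: "k < K" and \<omega>: "\<omega> \<in> space M"
  shows "(norm (z (Suc k) \<omega> - zs))\<^sup>2 + 1/2 * (norm (z (Suc k) \<omega> - zh (Suc k) \<omega>))\<^sup>2
    \<le> (1 - \<gamma> * (\<mu>F + \<mu>h) / 2) * ((norm (z k \<omega> - zs))\<^sup>2 + 1/2 * (norm (z k \<omega> - zh k \<omega>))\<^sup>2)
      + 6 * \<gamma>\<^sup>2 * ((norm (err (Suc k) \<omega>))\<^sup>2 + (norm (err k \<omega>))\<^sup>2 + D\<^sup>2)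
      - 2 * \<gamma> * (err (Suc k) \<omega> \<bullet> (zh (Suc k) \<omega> - zs))"
proof -
  let ?y = "zh (Suc k) \<omega>" and ?H = "\<lambda>x. real_of_ereal (h x)"
  let ?q = "(norm (?y - zs))\<^sup>2" and ?r = "(norm (z k \<omega> - zs))\<^sup>2" and ?b = "(norm (z k \<omega> - ?y))\<^sup>2"
    and ?d = "(norm (z k \<omega> - zh k \<omega>))\<^sup>2"
  have ydom: "?y \<in> edom h"
    by (rule zh_in_edom[OF \<omega> k])
  have zsdom: "zs \<in> edom h"
    by (rule vi_solution_edom[OF h(1) edom_Z zs])
  have "\<mu>h / 2 * ?q \<le> F zs \<bullet> (?y - zs) + ?H ?y - ?H zs"
    by (rule vi_solution_quadratic_growth[OF h(1) edom_Z zs sc ydom])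
  moreover have "\<mu>F * ?q \<le> (F ?y - F zs) \<bullet> (?y - zs)"
    using sm ydom zsdom edom_Z by (auto simp: strongly_monotone_on_def)
  ultimately have "(\<mu>F + \<mu>h / 2) * ?q \<le> F ?y \<bullet> (?y - zs) + ?H ?y - ?H zs"
    by (simp add: algebra_simps)
  then have "2 * \<gamma> * ((\<mu>F + \<mu>h / 2) * ?q) \<le> 2 * \<gamma> * (F ?y \<bullet> (?y - zs) + ?H ?y - ?H zs)"
    using \<gamma> by (intro mult_left_mono) auto
  moreover have "0 \<le> \<gamma> * \<mu>F * ?q"
    using \<gamma> \<mu> by simp
  ultimately have 1: "\<gamma> * (\<mu>F + \<mu>h) * ?q \<le> 2 * \<gamma> * (F ?y \<bullet> (?y - zs) + ?H ?y - ?H zs)"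
    by (simp add: algebra_simps)
  have 2: "\<gamma> * (\<mu>F + \<mu>h) * ?r \<le> \<gamma> * (\<mu>F + \<mu>h) * (2 * ?b + 2 * ?q)"
    using norm_add_squared_le[of "z k \<omega> - ?y" "?y - zs"] \<gamma> \<mu> by (intro mult_left_mono) auto
  have quarter: "\<gamma> * (\<mu>F + \<mu>h) * c \<le> 1/4 * c" if "c \<ge> 0" for c :: real
    using \<mu> that by (intro mult_right_mono) auto
  define m where "m = \<gamma> * (\<mu>F + \<mu>h)"
  have 3: "m * ?q \<le> 2 * \<gamma> * (F ?y \<bullet> (?y - zs) + ?H ?y - ?H zs)" "m * ?r \<le> 2 * (m * ?b) + 2 * (m * ?q)"
    "m * ?b \<le> 1/4 * ?b" "m * ?d \<le> 1/4 * ?d"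
    using 1 2 quarter[of ?b] quarter[of ?d] unfolding m_def[symmetric] by (auto simp: distrib_left)
  have 4: "2 * \<gamma> * ((F ?y + err (Suc k) \<omega>) \<bullet> (?y - zs) + ?H ?y - ?H zs)
      = 2 * \<gamma> * (F ?y \<bullet> (?y - zs) + ?H ?y - ?H zs) + 2 * \<gamma> * (err (Suc k) \<omega> \<bullet> (?y - zs))"
    by (simp add: inner_add_left distrib_left right_diff_distrib)
  have 5: "(1 - m / 2) * (?r + 1/2 * ?d) = ?r + 1/2 * ?d - 1/2 * (m * ?r) - 1/4 * (m * ?d)"
    by (simp add: field_simps)
  have "0 \<le> ?b" "0 \<le> ?d"
    by auto
  then show ?thesis
    using iterates_step[OF step k \<omega> zsdom] 3 unfolding 4 m_def[symmetric] 5 by linarith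
qed

lemma integrable_norm_diff:
  assumes "sq_integrable M f" "sq_integrable M g"
  shows "integrable M (\<lambda>\<omega>. (norm (f \<omega> - g \<omega>))\<^sup>2)"
  using sq_integrable_diff[OF assms] by (simp add: sq_integrable_def)

lemma integrable_err: "k \<le> K \<Longrightarrow> integrable M (\<lambda>\<omega>. (norm (err k \<omega>))\<^sup>2)"
  using err_sq_integrable[of k] by (simp add: sq_integrable_def)

lemma strongly_monotone_bound:
  assumes step: "288 * (\<gamma>\<^sup>2 * L\<^sup>2) \<le> 1" and zs: "vi_solution Z F h zs"
    and \<mu>: "\<mu>F \<ge> 0" "\<mu>h \<ge> 0" "\<mu>F + \<mu>h > 0" "4 * (\<gamma> * (\<mu>F + \<mu>h)) \<le> 1"
    and sm: "strongly_monotone_on Z F \<mu>F" and sc: "strongly_convex_fun_on Z h \<mu>h"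
  shows "(\<integral>\<omega>. (norm (z K \<omega> - zs))\<^sup>2 \<partial>M)
    \<le> (1 - \<gamma> * (\<mu>F + \<mu>h) / 2) ^ K * (norm (z0 - zs))\<^sup>2 + 12 * \<gamma> * (2 * \<sigma>\<^sup>2 + D\<^sup>2) / (\<mu>F + \<mu>h)"
proof -
  let ?\<mu> = "\<mu>F + \<mu>h"
  let ?V = "\<lambda>k \<omega>. (norm (z k \<omega> - zs))\<^sup>2 + 1/2 * (norm (z k \<omega> - zh k \<omega>))\<^sup>2"
  note sq = zh_sq_integrable z_sq_integrable sq_integrable_const
  have V: "integrable M (?V k)" if "k \<le> K" for k
    using that by (intro Bochner_Integration.integrable_add integrable_mult_right integrable_norm_diff sq)
  have rec: "(\<integral>\<omega>. ?V (Suc k) \<omega> \<partial>M)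
      \<le> (1 - \<gamma> * ?\<mu> / 2) * (\<integral>\<omega>. ?V k \<omega> \<partial>M) + 6 * \<gamma>\<^sup>2 * (2 * \<sigma>\<^sup>2 + D\<^sup>2)" if k: "k < K" for k
  proof -
    let ?I = "\<lambda>\<omega>. err (Suc k) \<omega> \<bullet> (zh (Suc k) \<omega> - zs)"
    have k': "Suc k \<le> K" "k \<le> K"
      using k by auto
    have yd: "sq_integrable M (\<lambda>\<omega>. zh (Suc k) \<omega> - zs)"
      using k' by (intro sq_integrable_diff sq)
    have I: "integrable M ?I"
      by (intro sq_integrable_inner err_sq_integrable yd k')
    \<comment> \<open>The error at index \<open>Suc k\<close> meets a vector determined by samples
      of smaller index.\<close>
    have I0: "(\<integral>\<omega>. ?I \<omega> \<partial>M) = 0"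
      using zh_measurable[OF k'(1)] by (intro err_orthogonal[OF k'(1) _ yd]) simp
    have lin: "(\<integral>\<omega>. a * f \<omega> + b * (g \<omega> + g' \<omega> + d) - c * i \<omega> \<partial>M)
        = a * (\<integral>\<omega>. f \<omega> \<partial>M) + b * ((\<integral>\<omega>. g \<omega> \<partial>M) + (\<integral>\<omega>. g' \<omega> \<partial>M) + d) - c * (\<integral>\<omega>. i \<omega> \<partial>M)"
      if "integrable M f" "integrable M g" "integrable M g'" "integrable M i"
      for f g g' i :: "'w \<Rightarrow> real" and a b c d :: real
      using that by (simp add: prob_space)
    have "(\<integral>\<omega>. ?V (Suc k) \<omega> \<partial>M)
        \<le> (\<integral>\<omega>. (1 - \<gamma> * ?\<mu> / 2) * ?V k \<omega>
            + 6 * \<gamma>\<^sup>2 * ((norm (err (Suc k) \<omega>))\<^sup>2 + (norm (err k \<omega>))\<^sup>2 + D\<^sup>2) - 2 * \<gamma> * ?I \<omega> \<partial>M)"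
      using strongly_monotone_step[OF step zs \<mu>(1,2,4) sm sc k]
      by (intro integral_mono V k' Bochner_Integration.integrable_diff Bochner_Integration.integrable_add
          integrable_mult_right I integrable_err) auto
    also have "\<dots> = (1 - \<gamma> * ?\<mu> / 2) * (\<integral>\<omega>. ?V k \<omega> \<partial>M)
        + 6 * \<gamma>\<^sup>2 * ((\<integral>\<omega>. (norm (err (Suc k) \<omega>))\<^sup>2 \<partial>M) + (\<integral>\<omega>. (norm (err k \<omega>))\<^sup>2 \<partial>M) + D\<^sup>2)
        - 2 * \<gamma> * (\<integral>\<omega>. ?I \<omega> \<partial>M)"
      by (intro lin V I integrable_err k')
    also have "\<dots> \<le> (1 - \<gamma> * ?\<mu> / 2) * (\<integral>\<omega>. ?V k \<omega> \<partial>M) + 6 * \<gamma>\<^sup>2 * (\<sigma>\<^sup>2 + \<sigma>\<^sup>2 + D\<^sup>2) - 2 * \<gamma> * 0"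
      using I0 err_second_moment k' less_imp_le[OF \<gamma>]
      by (intro add_mono diff_mono order_refl mult_left_mono) auto
    finally show ?thesis
      by simp
  qed
  have pos: "0 < \<gamma> * ?\<mu>"
    using \<gamma> \<mu> by simp
  have "(\<integral>\<omega>. (norm (z K \<omega> - zs))\<^sup>2 \<partial>M) \<le> (\<integral>\<omega>. ?V K \<omega> \<partial>M)"
    by (intro integral_mono V integrable_norm_diff sq) auto
  also have "\<dots> \<le> (1 - \<gamma> * ?\<mu> / 2) ^ K * (\<integral>\<omega>. ?V 0 \<omega> \<partial>M)
      + 6 * \<gamma>\<^sup>2 * (2 * \<sigma>\<^sup>2 + D\<^sup>2) / (1 - (1 - \<gamma> * ?\<mu> / 2))"
    using pos \<mu>(4) by (intro affine_recursion_bound[where n = K] rec) auto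
  \<comment> \<open>Both sequences start at \<open>z0\<close>, so the second part of the Lyapunov
    function vanishes initially.\<close>
  also have "(\<integral>\<omega>. ?V 0 \<omega> \<partial>M) = (\<integral>\<omega>. (norm (z0 - zs))\<^sup>2 \<partial>M)"
    by (intro Bochner_Integration.integral_cong) (auto simp: z_0 zh_0)
  also have "6 * \<gamma>\<^sup>2 * (2 * \<sigma>\<^sup>2 + D\<^sup>2) / (1 - (1 - \<gamma> * ?\<mu> / 2)) = 12 * \<gamma> * (2 * \<sigma>\<^sup>2 + D\<^sup>2) / ?\<mu>"
  proof -
    have "6 * \<gamma>\<^sup>2 * c / (1 - (1 - \<gamma> * m / 2)) = 12 * \<gamma> * c / m" if "m > 0" for c m :: real
      using \<gamma> that by (simp add: power2_eq_square)
    from this[OF \<mu>(3)] show ?thesis .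
  qed
  finally show ?thesis
    by (simp add: prob_space)
qed

section \<open>Monotone case\<close>

lemma noise_sum_second_moment:
  assumes "n \<le> K"
  shows "(\<lambda>\<omega>. \<Sum>k<n. err (Suc k) \<omega>) \<in> borel_measurable (past (Suc n)) \<and>
    sq_integrable M (\<lambda>\<omega>. \<Sum>k<n. err (Suc k) \<omega>) \<and>
    (\<integral>\<omega>. (norm (\<Sum>k<n. err (Suc k) \<omega>))\<^sup>2 \<partial>M) \<le> real n * \<sigma>\<^sup>2"
  using assms
proof (induction n)
  case 0
  then show ?case
    by (simp add: sq_integrable_const)
next
  case (Suc n)
  let ?S = "\<lambda>\<omega>. \<Sum>k<n. err (Suc k) \<omega>"
  have IH: "?S \<in> borel_measurable (past (Suc n))" "sq_integrable M ?S"
    "(\<integral>\<omega>. (norm (?S \<omega>))\<^sup>2 \<partial>M) \<le> real n * \<sigma>\<^sup>2"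
    using Suc by auto
  have err: "sq_integrable M (err (Suc n))"
    by (rule err_sq_integrable[OF Suc.prems])
  have I: "integrable M (\<lambda>\<omega>. err (Suc n) \<omega> \<bullet> ?S \<omega>)"
    by (rule sq_integrable_inner[OF err IH(2)])
  have S: "integrable M (\<lambda>\<omega>. (norm (?S \<omega>))\<^sup>2)"
    using IH(2) by (simp add: sq_integrable_def)
  have "(\<lambda>\<omega>. \<Sum>k<Suc n. err (Suc k) \<omega>) \<in> borel_measurable (past (Suc (Suc n)))"
    using Suc.prems by (intro borel_measurable_sum err_measurable) auto
  moreover have "sq_integrable M (\<lambda>\<omega>. \<Sum>k<Suc n. err (Suc k) \<omega>)"
    using sq_integrable_add[OF IH(2) err] by simp
  moreover have "(\<integral>\<omega>. (norm (\<Sum>k<Suc n. err (Suc k) \<omega>))\<^sup>2 \<partial>M)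
      = (\<integral>\<omega>. (norm (?S \<omega>))\<^sup>2 + 2 * (err (Suc n) \<omega> \<bullet> ?S \<omega>) + (norm (err (Suc n) \<omega>))\<^sup>2 \<partial>M)"
    by (intro Bochner_Integration.integral_cong refl)
       (simp add: power2_norm_eq_inner inner_add_left inner_add_right inner_commute)
  moreover have "\<dots> = (\<integral>\<omega>. (norm (?S \<omega>))\<^sup>2 \<partial>M) + 2 * (\<integral>\<omega>. err (Suc n) \<omega> \<bullet> ?S \<omega> \<partial>M)
      + (\<integral>\<omega>. (norm (err (Suc n) \<omega>))\<^sup>2 \<partial>M)"
    using S I integrable_err[OF Suc.prems] by simp
  \<comment> \<open>Without cross terms the second moment grows like \<open>n\<close> rather than
    its square. Measurability of the partial sum is carried through the induction for this
    step.\<close>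
  moreover have "(\<integral>\<omega>. err (Suc n) \<omega> \<bullet> ?S \<omega> \<partial>M) = 0"
    by (rule err_orthogonal[OF Suc.prems IH(1,2)])
  ultimately show ?case
    using IH(3) err_second_moment[OF Suc.prems] by (simp add: algebra_simps)
qed

definition zhat :: "'w \<Rightarrow> 'a" where
  "zhat \<omega> = (1 / real K) *\<^sub>R (\<Sum>k<K. zh (Suc k) \<omega>)"

text \<open>The part of the bound on \<open>2 \<gamma> K\<close> times the gap that does not depend on the comparison point.\<close>

definition gap_excess :: "'w \<Rightarrow> real" where
  "gap_excess \<omega> = (\<Sum>k<K. 6 * \<gamma>\<^sup>2 * ((norm (err (Suc k) \<omega>))\<^sup>2 + (norm (err k \<omega>))\<^sup>2 + D\<^sup>2)
            - 2 * \<gamma> * (err (Suc k) \<omega> \<bullet> (zh (Suc k) \<omega> - z0)))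
        + \<gamma>\<^sup>2 * (norm (\<Sum>k<K. err (Suc k) \<omega>))\<^sup>2"

text \<open>Each step contributes 6 \<gamma>^2 (2 \<sigma>^2 + D^2), as the inner products with
  \<open>zh (Suc k) - z0\<close> have mean zero. The squared error sum adds one more \<gamma>^2
  \<sigma>^2 per step, hence 13.\<close>

lemma gap_excess_integrable: "integrable M gap_excess"
  and gap_excess_expectation: "(\<integral>\<omega>. gap_excess \<omega> \<partial>M) \<le> real K * (\<gamma>\<^sup>2 * (13 * \<sigma>\<^sup>2 + 6 * D\<^sup>2))"
proof -
  let ?I = "\<lambda>k \<omega>. err (Suc k) \<omega> \<bullet> (zh (Suc k) \<omega> - z0)"
  let ?w = "\<lambda>k \<omega>. 6 * \<gamma>\<^sup>2 * ((norm (err (Suc k) \<omega>))\<^sup>2 + (norm (err k \<omega>))\<^sup>2 + D\<^sup>2) - 2 * \<gamma> * ?I k \<omega>"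
  have yd: "sq_integrable M (\<lambda>\<omega>. zh (Suc k) \<omega> - z0)" if "k < K" for k
    using that by (intro sq_integrable_diff zh_sq_integrable sq_integrable_const) auto
  have I: "integrable M (?I k)" if "k < K" for k
    using that by (intro sq_integrable_inner err_sq_integrable yd) auto
  have w: "integrable M (?w k)" if "k < K" for k
    using that by (intro Bochner_Integration.integrable_diff Bochner_Integration.integrable_add
          integrable_mult_right I integrable_err) auto
  have S: "integrable M (\<lambda>\<omega>. (norm (\<Sum>k<K. err (Suc k) \<omega>))\<^sup>2)"
    using noise_sum_second_moment[of K] by (simp add: sq_integrable_def)
  have wE: "(\<integral>\<omega>. ?w k \<omega> \<partial>M) \<le> 6 * \<gamma>\<^sup>2 * (2 * \<sigma>\<^sup>2 + D\<^sup>2)" if k: "k < K" for k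
  proof -
    have k': "Suc k \<le> K" "k \<le> K"
      using k by auto
    have I0: "(\<integral>\<omega>. ?I k \<omega> \<partial>M) = 0"
      using zh_measurable[OF k'(1)] by (intro err_orthogonal[OF k'(1) _ yd[OF k]]) simp
    have "(\<integral>\<omega>. ?w k \<omega> \<partial>M)
        = 6 * \<gamma>\<^sup>2 * ((\<integral>\<omega>. (norm (err (Suc k) \<omega>))\<^sup>2 \<partial>M) + (\<integral>\<omega>. (norm (err k \<omega>))\<^sup>2 \<partial>M) + D\<^sup>2)
        - 2 * \<gamma> * (\<integral>\<omega>. ?I k \<omega> \<partial>M)"
      using I[OF k] integrable_err[OF k'(1)] integrable_err[OF k'(2)] by (simp add: prob_space)
    also have "\<dots> \<le> 6 * \<gamma>\<^sup>2 * (\<sigma>\<^sup>2 + \<sigma>\<^sup>2 + D\<^sup>2) - 2 * \<gamma> * 0"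
      using I0 err_second_moment k' less_imp_le[OF \<gamma>]
      by (intro add_mono diff_mono order_refl mult_left_mono) auto
    finally show ?thesis
      by simp
  qed
  have sum: "integrable M (\<lambda>\<omega>. \<Sum>k<K. ?w k \<omega>)"
    using w by (intro Bochner_Integration.integrable_sum) auto
  show "integrable M gap_excess"
    unfolding gap_excess_def[abs_def] using sum S
    by (intro Bochner_Integration.integrable_add integrable_mult_right)
  have "(\<integral>\<omega>. gap_excess \<omega> \<partial>M) = (\<integral>\<omega>. (\<Sum>k<K. ?w k \<omega>) \<partial>M)
      + (\<integral>\<omega>. \<gamma>\<^sup>2 * (norm (\<Sum>k<K. err (Suc k) \<omega>))\<^sup>2 \<partial>M)"
    unfolding gap_excess_def[abs_def] using sum S
    by (intro Bochner_Integration.integral_add integrable_mult_right)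
  also have "\<dots> = (\<Sum>k<K. \<integral>\<omega>. ?w k \<omega> \<partial>M) + \<gamma>\<^sup>2 * (\<integral>\<omega>. (norm (\<Sum>k<K. err (Suc k) \<omega>))\<^sup>2 \<partial>M)"
    using w by (subst Bochner_Integration.integral_sum) auto
  also have "\<dots> \<le> (\<Sum>k<K. 6 * \<gamma>\<^sup>2 * (2 * \<sigma>\<^sup>2 + D\<^sup>2)) + \<gamma>\<^sup>2 * (real K * \<sigma>\<^sup>2)"
    using wE noise_sum_second_moment[of K] by (intro add_mono sum_mono mult_left_mono) auto
  finally show "(\<integral>\<omega>. gap_excess \<omega> \<partial>M) \<le> real K * (\<gamma>\<^sup>2 * (13 * \<sigma>\<^sup>2 + 6 * D\<^sup>2))"
    by (simp add: algebra_simps)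
qed

lemma zhat_in_edom:
  assumes "K \<ge> 1" "\<omega> \<in> space M"
  shows "zhat \<omega> \<in> edom h"
  unfolding zhat_def scaleR_sum_right
  using assms zh_in_edom convex_on_edom[OF h(1,3)]
  by (intro convex_sum) (auto simp: convex_on_def)

text \<open>The half of \<open>|z n - zh n|^2\<close> left over by one step covers the 1/24 that the
  next step asks for; it is therefore kept on the left in the induction.\<close>

lemma telescoped_steps:
  assumes step: "288 * (\<gamma>\<^sup>2 * L\<^sup>2) \<le> 1" and \<omega>: "\<omega> \<in> space M" and u: "u \<in> edom h" and n: "n \<le> K"
  shows "(\<Sum>k<n. 2 * \<gamma> * ((F (zh (Suc k) \<omega>) + err (Suc k) \<omega>) \<bullet> (zh (Suc k) \<omega> - u)
            + real_of_ereal (h (zh (Suc k) \<omega>)) - real_of_ereal (h u)))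
      + (norm (z n \<omega> - u))\<^sup>2 + 1/2 * (norm (z n \<omega> - zh n \<omega>))\<^sup>2
    \<le> (norm (z0 - u))\<^sup>2 + (\<Sum>k<n. 6 * \<gamma>\<^sup>2 * ((norm (err (Suc k) \<omega>))\<^sup>2 + (norm (err k \<omega>))\<^sup>2 + D\<^sup>2))"
  using n
proof (induction n)
  case 0
  then show ?case
    by (simp add: z_0[OF \<omega>] zh_0[OF \<omega>])
next
  case (Suc n)
  then have "n < K"
    by simp
  from iterates_step[OF step this \<omega> u] Suc show ?case
    using zero_le_power2[of "norm (z n \<omega> - zh n \<omega>)"] zero_le_power2[of "norm (z n \<omega> - zh (Suc n) \<omega>)"]
    unfolding sum.lessThan_Suc by linarith
qed

lemma gap_term_le:
  assumes step: "288 * (\<gamma>\<^sup>2 * L\<^sup>2) \<le> 1" and K: "K \<ge> 1" and \<omega>: "\<omega> \<in> space M" and u: "u \<in> edom h"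
    and mono: "strongly_monotone_on Z F 0"
  shows "2 * \<gamma> * real K * (F u \<bullet> (zhat \<omega> - u) - real_of_ereal (h u) + real_of_ereal (h (zhat \<omega>)))
    \<le> 2 * (norm (z0 - u))\<^sup>2 + gap_excess \<omega>"
proof -
  let ?H = "\<lambda>x. real_of_ereal (h x)" and ?y = "\<lambda>k. zh (Suc k) \<omega>" and ?err = "\<lambda>k. err (Suc k) \<omega>"
  let ?S = "\<Sum>k<K. ?err k"
  let ?N = "\<lambda>k. 6 * \<gamma>\<^sup>2 * ((norm (err (Suc k) \<omega>))\<^sup>2 + (norm (err k \<omega>))\<^sup>2 + D\<^sup>2)"
  have ydom: "?y k \<in> edom h" if "k < K" for k
    by (rule zh_in_edom[OF \<omega> that])
  have sum_y: "(\<Sum>k<K. ?y k) = real K *\<^sub>R zhat \<omega>"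
    using K by (simp add: zhat_def)
  have "?H (zhat \<omega>) \<le> (\<Sum>k<K. 1 / real K * ?H (?y k))"
    unfolding zhat_def scaleR_sum_right using K ydom
    by (intro convex_on_sum[OF _ _ convex_on_edom[OF h(1,3)]]) (auto simp: lessThan_empty_iff)
  then have jensen: "real K * ?H (zhat \<omega>) \<le> (\<Sum>k<K. ?H (?y k))"
    using K by (simp add: sum_divide_distrib[symmetric] field_simps)
  have "real K * (F u \<bullet> (zhat \<omega> - u)) = F u \<bullet> ((\<Sum>k<K. ?y k) - real K *\<^sub>R u)"
    unfolding sum_y by (simp add: algebra_simps)
  also have "\<dots> = (\<Sum>k<K. F u \<bullet> (?y k - u))"
    by (simp add: inner_diff_right inner_sum_right sum_subtractf)
  finally have lin: "real K * (F u \<bullet> (zhat \<omega> - u)) = (\<Sum>k<K. F u \<bullet> (?y k - u))" .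
  have "real K * (F u \<bullet> (zhat \<omega> - u) - ?H u + ?H (zhat \<omega>))
      \<le> (\<Sum>k<K. F u \<bullet> (?y k - u)) - real K * ?H u + (\<Sum>k<K. ?H (?y k))"
    using jensen lin by (simp add: algebra_simps)
  also have "\<dots> = (\<Sum>k<K. F u \<bullet> (?y k - u) + ?H (?y k) - ?H u)"
    by (simp add: sum.distrib sum_subtractf)
  \<comment> \<open>Monotonicity trades \<open>F u\<close>, which averages linearly over the
    iterates, for the operator values that the algorithm sees.\<close>
  also have "\<dots> \<le> (\<Sum>k<K. F (?y k) \<bullet> (?y k - u) + ?H (?y k) - ?H u)"
  proof (rule sum_mono)
    fix k assume "k \<in> {..<K}"
    then have "0 \<le> (F (?y k) - F u) \<bullet> (?y k - u)"
      using mono ydom[of k] u edom_Z by (auto simp: strongly_monotone_on_def)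
    then show "F u \<bullet> (?y k - u) + ?H (?y k) - ?H u \<le> F (?y k) \<bullet> (?y k - u) + ?H (?y k) - ?H u"
      by (simp add: inner_diff_left)
  qed
  finally have "2 * \<gamma> * (real K * (F u \<bullet> (zhat \<omega> - u) - ?H u + ?H (zhat \<omega>)))
      \<le> 2 * \<gamma> * (\<Sum>k<K. F (?y k) \<bullet> (?y k - u) + ?H (?y k) - ?H u)"
    using \<gamma> by (intro mult_left_mono) auto
  also have "\<dots> = (\<Sum>k<K. 2 * \<gamma> * ((F (?y k) + ?err k) \<bullet> (?y k - u) + ?H (?y k) - ?H u)
      - 2 * \<gamma> * (?err k \<bullet> (?y k - u)))"
    unfolding sum_distrib_left by (intro sum.cong refl) (simp add: inner_add_left algebra_simps)
  also have "\<dots> \<le> (norm (z0 - u))\<^sup>2 + (\<Sum>k<K. ?N k) - (\<Sum>k<K. 2 * \<gamma> * (?err k \<bullet> (?y k - u)))"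
    using telescoped_steps[OF step \<omega> u order_refl]
      zero_le_power2[of "norm (z K \<omega> - u)"] zero_le_power2[of "norm (z K \<omega> - zh K \<omega>)"]
    unfolding sum_subtractf by linarith
  \<comment> \<open>\<open>z0\<close> is deterministic: the part up to \<open>z0\<close> has mean
    zero and is free of \<open>u\<close>, and \<open>u\<close> remains only beside the total
    error.\<close>
  also have "(\<Sum>k<K. 2 * \<gamma> * (?err k \<bullet> (?y k - u)))
      = (\<Sum>k<K. 2 * \<gamma> * (?err k \<bullet> (?y k - z0)) + 2 * \<gamma> * (?err k \<bullet> (z0 - u)))"
    by (intro sum.cong refl) (simp add: inner_diff_right algebra_simps)
  also have "\<dots> = (\<Sum>k<K. 2 * \<gamma> * (?err k \<bullet> (?y k - z0))) + 2 * \<gamma> * (?S \<bullet> (z0 - u))"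
    by (simp add: sum.distrib inner_sum_left sum_distrib_left)
  \<comment> \<open>Completing the square absorbs the last inner product. Its price is a second
    \<open>|z0 - u|^2\<close> and the squared error sum in \<open>gap_excess\<close>.\<close>
  also have "(norm (z0 - u))\<^sup>2 + (\<Sum>k<K. ?N k)
        - ((\<Sum>k<K. 2 * \<gamma> * (?err k \<bullet> (?y k - z0))) + 2 * \<gamma> * (?S \<bullet> (z0 - u)))
      = 2 * (norm (z0 - u))\<^sup>2 + gap_excess \<omega> - (norm (\<gamma> *\<^sub>R ?S + (z0 - u)))\<^sup>2"
  proof -
    have "(norm (\<gamma> *\<^sub>R ?S + (z0 - u)))\<^sup>2
        = \<gamma>\<^sup>2 * (norm ?S)\<^sup>2 + 2 * \<gamma> * (?S \<bullet> (z0 - u)) + (norm (z0 - u))\<^sup>2"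
      unfolding power2_norm_eq_inner
      by (simp add: inner_add_left inner_add_right inner_commute power2_eq_square del: inner_diff_right inner_diff_left)
    then show ?thesis
      unfolding gap_excess_def sum_subtractf by simp
  qed
  also have "\<dots> \<le> 2 * (norm (z0 - u))\<^sup>2 + gap_excess \<omega>"
    by simp
  finally show ?thesis
    by (simp add: mult.assoc)
qed

text \<open>The lower bound comes from the term \<open>u = zs\<close>. In the upper bound
  \<open>u\<close> enters only through \<open>|z0 - u|^2\<close>, so the supremum can be taken for
  each outcome separately.\<close>

lemma Gap_bound:
  assumes step: "288 * (\<gamma>\<^sup>2 * L\<^sup>2) \<le> 1" and K: "K \<ge> 1" and \<omega>: "\<omega> \<in> space M"
    and zs: "vi_solution Z F h zs" "zs \<in> C" and C: "compact C"
    and mono: "strongly_monotone_on Z F 0"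
  shows "0 \<le> Gap F h C (zhat \<omega>)"
    and "Gap F h C (zhat \<omega>) \<le> ereal ((2 * (SUP u\<in>C. (norm (z0 - u))\<^sup>2) + gap_excess \<omega>) / (2 * \<gamma> * real K))"
proof -
  have dom: "zhat \<omega> \<in> edom h"
    by (rule zhat_in_edom[OF K \<omega>])
  have "0 \<le> ereal (F zs \<bullet> (zhat \<omega> - zs)) + h (zhat \<omega>) - h zs"
    using zs(1) dom edom_Z by (auto simp: vi_solution_def)
  also have "\<dots> \<le> Gap F h C (zhat \<omega>)"
    unfolding Gap_def by (rule SUP_upper[OF zs(2)])
  finally show "0 \<le> Gap F h C (zhat \<omega>)" .
  have "compact ((\<lambda>u. (norm (z0 - u))\<^sup>2) ` C)"
    by (intro compact_continuous_image continuous_intros C)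
  then have bdd: "bdd_above ((\<lambda>u. (norm (z0 - u))\<^sup>2) ` C)"
    by (intro bounded_imp_bdd_above compact_imp_bounded)
  show "Gap F h C (zhat \<omega>) \<le> ereal ((2 * (SUP u\<in>C. (norm (z0 - u))\<^sup>2) + gap_excess \<omega>) / (2 * \<gamma> * real K))"
    unfolding Gap_eq_SUP_edom[OF h(1) dom]
  proof (rule SUP_least)
    fix u assume u: "u \<in> C \<inter> edom h"
    have "2 * \<gamma> * real K * (F u \<bullet> (zhat \<omega> - u) - real_of_ereal (h u) + real_of_ereal (h (zhat \<omega>)))
        \<le> 2 * (norm (z0 - u))\<^sup>2 + gap_excess \<omega>"
      using gap_term_le[OF step K \<omega> _ mono] u by auto
    also have "\<dots> \<le> 2 * (SUP u\<in>C. (norm (z0 - u))\<^sup>2) + gap_excess \<omega>"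
      using cSUP_upper[OF _ bdd, of u] u by simp
    finally show "ereal (F u \<bullet> (zhat \<omega> - u) - real_of_ereal (h u) + real_of_ereal (h (zhat \<omega>)))
        \<le> ereal ((2 * (SUP u\<in>C. (norm (z0 - u))\<^sup>2) + gap_excess \<omega>) / (2 * \<gamma> * real K))"
      using \<gamma> K by (simp add: field_simps)
  qed
qed

lemma expected_Gap_bound:
  assumes step: "288 * (\<gamma>\<^sup>2 * L\<^sup>2) \<le> 1" and K: "K \<ge> 1"
    and zs: "vi_solution Z F h zs" "zs \<in> C" and C: "compact C"
    and mono: "strongly_monotone_on Z F 0"
  shows "AE \<omega> in M. \<bar>Gap F h C (zhat \<omega>)\<bar> \<noteq> \<infinity>"
    and "integrable M (\<lambda>\<omega>. real_of_ereal (Gap F h C (zhat \<omega>)))"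
    and "(\<integral>\<omega>. real_of_ereal (Gap F h C (zhat \<omega>)) \<partial>M)
      \<le> (SUP u\<in>C. (norm (z0 - u))\<^sup>2) / (\<gamma> * real K) + \<gamma> * (13 * \<sigma>\<^sup>2 + 6 * D\<^sup>2) / 2"
proof -
  let ?\<Omega> = "SUP u\<in>C. (norm (z0 - u))\<^sup>2"
  let ?g = "\<lambda>\<omega>. real_of_ereal (Gap F h C (zhat \<omega>))"
  let ?B = "\<lambda>\<omega>. (2 * ?\<Omega> + gap_excess \<omega>) / (2 * \<gamma> * real K)"
  note bound = Gap_bound[OF step K _ zs C mono]
  \<comment> \<open>The bounds from both sides exclude both infinite values; they also dominate the
    gap by an integrable function below.\<close>
  have fin: "\<bar>Gap F h C (zhat \<omega>)\<bar> \<noteq> \<infinity>" if "\<omega> \<in> space M" for \<omega>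
    using bound[OF that] by (cases "Gap F h C (zhat \<omega>)") auto
  then show "AE \<omega> in M. \<bar>Gap F h C (zhat \<omega>)\<bar> \<noteq> \<infinity>"
    by (intro AE_I2)
  have g: "0 \<le> ?g \<omega>" "?g \<omega> \<le> ?B \<omega>" if "\<omega> \<in> space M" for \<omega>
    using bound[OF that] fin[OF that] by (cases "Gap F h C (zhat \<omega>)"; auto)+
  have B: "integrable M ?B"
    using gap_excess_integrable by simp
  have "zhat \<in> borel_measurable M"
    unfolding zhat_def[abs_def] using zh_sq_integrable
    by (intro borel_measurable_scaleR borel_measurable_const borel_measurable_sum) (auto simp: sq_integrable_def)
  from borel_measurable_Gap[OF h(1,2) this zhat_in_edom[OF K]]
  have "?g \<in> borel_measurable M"
    by (rule borel_measurable_real_of_ereal)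
  moreover have "norm (?g \<omega>) \<le> norm (?B \<omega>)" if "\<omega> \<in> space M" for \<omega>
    using g[OF that] unfolding real_norm_def by linarith
  ultimately show int: "integrable M ?g"
    by (intro Bochner_Integration.integrable_bound[OF B] AE_I2)
  have "(\<integral>\<omega>. ?g \<omega> \<partial>M) \<le> (\<integral>\<omega>. ?B \<omega> \<partial>M)"
    by (rule integral_mono[OF int B g(2)])
  also have "\<dots> = (2 * ?\<Omega> + (\<integral>\<omega>. gap_excess \<omega> \<partial>M)) / (2 * \<gamma> * real K)"
    using gap_excess_integrable by (simp add: prob_space)
  also have "\<dots> \<le> (2 * ?\<Omega> + real K * (\<gamma>\<^sup>2 * (13 * \<sigma>\<^sup>2 + 6 * D\<^sup>2))) / (2 * \<gamma> * real K)"
    using gap_excess_expectation \<gamma> by (intro divide_right_mono add_left_mono) auto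
  also have "\<dots> = ?\<Omega> / (\<gamma> * real K) + \<gamma> * (13 * \<sigma>\<^sup>2 + 6 * D\<^sup>2) / 2"
    using \<gamma> K by (simp add: field_simps power2_eq_square)
  finally show "(\<integral>\<omega>. ?g \<omega> \<partial>M) \<le> ?\<Omega> / (\<gamma> * real K) + \<gamma> * (13 * \<sigma>\<^sup>2 + 6 * D\<^sup>2) / 2" .
qed

end

text \<open>288 is the square of 12 sqrt 2. For \<open>L = 0\<close> the extended quotient is
  \<infinity> and bounds nothing, but the conclusion is then trivial.\<close>

lemma step_size_bound:
  assumes "\<gamma> > 0" "L \<ge> 0" "ereal \<gamma> \<le> 1 / ereal (12 * L * sqrt 2)"
  shows "288 * (\<gamma>\<^sup>2 * L\<^sup>2) \<le> 1"
proof (cases "L = 0")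
  case False
  then have L: "L > 0"
    using assms by simp
  then have "\<gamma> \<le> 1 / (12 * L * sqrt 2)"
    using assms by (simp add: one_ereal_def)
  then have "\<gamma> * (12 * L * sqrt 2) \<le> 1"
    using L by (simp add: field_simps)
  then have "(\<gamma> * (12 * L * sqrt 2))\<^sup>2 \<le> 1\<^sup>2"
    using assms by (intro power_mono) auto
  then show ?thesis
    by (simp add: power_mult_distrib)
qed simp

theorem mainTheorem4:
  fixes h :: "'a::euclidean_space \<Rightarrow> ereal"
    and F :: "'a \<Rightarrow> 'a"
    and Z :: "'a set"
    and zs z0 :: 'a
    and L D \<sigma> \<gamma> :: real
    and K :: nat
    and M :: "'w measure"
    and P :: "'s measure"
    and G :: "'a \<Rightarrow> 's \<Rightarrow> 'a"
    and \<xi> :: "nat \<Rightarrow> 'w \<Rightarrow> 's"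
    and z zh :: "nat \<Rightarrow> 'w \<Rightarrow> 'a"
  assumes h: "proper_fun h" "lsc_fun h" "convex_fun h"
    and Z: "Z \<noteq> {}" "closed Z" "convex Z" "edom h \<subseteq> Z"
    and zs: "vi_solution Z F h zs"
    and noise: "unbiased_sampling P G F (\<sigma>\<^sup>2)"
    and lipschitz: "L \<ge> 0" "boundedly_lipschitz_on Z F L D"
    and M: "prob_space M"
    and samples: "iid_samples M P \<xi>"
    and K: "K \<ge> 1"
    and z0: "z0 \<in> Z"
    and \<gamma>: "\<gamma> > 0"
    and iterates: "\<And>\<omega>. \<omega> \<in> space M \<Longrightarrow>
      past_es \<gamma> h G (\<lambda>k. \<xi> k \<omega>) z0 K (\<lambda>k. z k \<omega>) (\<lambda>k. zh k \<omega>)"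
  shows
    "(\<forall>\<mu>F \<mu>h.
        \<mu>F \<ge> 0 \<and> \<mu>h \<ge> 0 \<and> \<mu>F + \<mu>h > 0 \<and>
        strongly_monotone_on Z F \<mu>F \<and> strongly_convex_fun_on Z h \<mu>h \<and>
        ereal \<gamma> \<le> min (1 / ereal (12 * L * sqrt 2)) (1 / ereal (4 * (\<mu>F + \<mu>h))) \<longrightarrow>
        integrable M (\<lambda>\<omega>. (norm (z K \<omega> - zs))\<^sup>2) \<and>
        (\<integral>\<omega>. (norm (z K \<omega> - zs))\<^sup>2 \<partial>M) \<le>
          (1 - \<gamma> * ((\<mu>F + \<mu>h) / 16)) ^ (K - 1) * (norm (z0 - zs))\<^sup>2
          + 192 * \<gamma> * (37 * \<sigma>\<^sup>2 + 12 * D\<^sup>2) / (\<mu>F + \<mu>h)) \<and>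
     (\<forall>C.
        compact C \<and> C \<subseteq> Z \<and> zs \<in> C \<and>
        strongly_monotone_on Z F 0 \<and> strongly_convex_fun_on Z h 0 \<and>
        ereal \<gamma> \<le> 1 / ereal (12 * L * sqrt 2) \<longrightarrow>
        (let zhat = (\<lambda>\<omega>. (1 / real K) *\<^sub>R (\<Sum>k<K. zh (Suc k) \<omega>));
             \<sigma>0sq = (\<lambda>\<omega>. (norm (F (zh 0 \<omega>) - F (zh 1 \<omega>)))\<^sup>2)
         in integrable M \<sigma>0sq \<and>
            (AE \<omega> in M. \<bar>Gap F h C (zhat \<omega>)\<bar> \<noteq> \<infinity>) \<and>
            integrable M (\<lambda>\<omega>. real_of_ereal (Gap F h C (zhat \<omega>))) \<and>
            (\<integral>\<omega>. real_of_ereal (Gap F h C (zhat \<omega>)) \<partial>M) \<le>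
              (8 * (SUP u\<in>C. (norm (z0 - u))\<^sup>2) + 72 * \<gamma>\<^sup>2 * (\<integral>\<omega>. \<sigma>0sq \<omega> \<partial>M)) / (\<gamma> * real K)
              + \<gamma> * (216 * D\<^sup>2 + 691 * \<sigma>\<^sup>2)))"
proof -
  have L: "L \<ge> 0"
    by (rule lipschitz(1))
  interpret prob_space M
    by (rule M)
  interpret past_es_process M h F Z z0 L D \<sigma> \<gamma> K P G \<xi> z zh
    using h Z(4) noise lipschitz(2) samples z0 \<gamma> iterates by unfold_locales
  show ?thesis
  proof (intro conjI allI impI)
    fix \<mu>F \<mu>h :: real
    assume *: "\<mu>F \<ge> 0 \<and> \<mu>h \<ge> 0 \<and> \<mu>F + \<mu>h > 0 \<and>
        strongly_monotone_on Z F \<mu>F \<and> strongly_convex_fun_on Z h \<mu>h \<and>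
        ereal \<gamma> \<le> min (1 / ereal (12 * L * sqrt 2)) (1 / ereal (4 * (\<mu>F + \<mu>h)))"
    let ?\<mu> = "\<mu>F + \<mu>h"
    have step: "288 * (\<gamma>\<^sup>2 * L\<^sup>2) \<le> 1"
      using * by (intro step_size_bound \<gamma> L) auto
    have "ereal \<gamma> \<le> 1 / ereal (4 * ?\<mu>)"
      using * by simp
    then have "\<gamma> \<le> 1 / (4 * ?\<mu>)"
      using * by (simp add: one_ereal_def)
    then have \<mu>: "4 * (\<gamma> * ?\<mu>) \<le> 1"
      using * by (simp add: field_simps)
    have pos: "0 < \<gamma> * ?\<mu>"
      using * \<gamma> by simp
    show "integrable M (\<lambda>\<omega>. (norm (z K \<omega> - zs))\<^sup>2)"
      by (intro integrable_norm_diff z_sq_integrable sq_integrable_const order_refl)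
    have "(\<integral>\<omega>. (norm (z K \<omega> - zs))\<^sup>2 \<partial>M)
        \<le> (1 - \<gamma> * ?\<mu> / 2) ^ K * (norm (z0 - zs))\<^sup>2 + 12 * \<gamma> * (2 * \<sigma>\<^sup>2 + D\<^sup>2) / ?\<mu>"
      using * \<mu> by (intro strongly_monotone_bound step zs) auto
    \<comment> \<open>Weakening to the claimed constants: the rate 1/2 drops to 1/16, and since the
      base lies between 0 and 1 the exponent may drop to \<open>K - 1\<close>.\<close>
    also have "\<dots> \<le> (1 - \<gamma> * (?\<mu> / 16)) ^ (K - 1) * (norm (z0 - zs))\<^sup>2
        + 192 * \<gamma> * (37 * \<sigma>\<^sup>2 + 12 * D\<^sup>2) / ?\<mu>"
    proof (intro add_mono mult_right_mono)
      have "(1 - \<gamma> * ?\<mu> / 2) ^ K \<le> (1 - \<gamma> * (?\<mu> / 16)) ^ K"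
        using \<mu> pos by (intro power_mono) auto
      also have "\<dots> \<le> (1 - \<gamma> * (?\<mu> / 16)) ^ (K - 1)"
        using \<mu> pos by (intro power_decreasing) auto
      finally show "(1 - \<gamma> * ?\<mu> / 2) ^ K \<le> (1 - \<gamma> * (?\<mu> / 16)) ^ (K - 1)" .
      have "\<gamma> * (12 * (2 * \<sigma>\<^sup>2 + D\<^sup>2)) \<le> \<gamma> * (192 * (37 * \<sigma>\<^sup>2 + 12 * D\<^sup>2))"
        using \<gamma> zero_le_power2[of \<sigma>] zero_le_power2[of D] by (intro mult_left_mono) auto
      then show "12 * \<gamma> * (2 * \<sigma>\<^sup>2 + D\<^sup>2) / ?\<mu> \<le> 192 * \<gamma> * (37 * \<sigma>\<^sup>2 + 12 * D\<^sup>2) / ?\<mu>"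
        using * by (intro divide_right_mono) (auto simp: algebra_simps)
    qed simp
    finally show "(\<integral>\<omega>. (norm (z K \<omega> - zs))\<^sup>2 \<partial>M)
        \<le> (1 - \<gamma> * (?\<mu> / 16)) ^ (K - 1) * (norm (z0 - zs))\<^sup>2
          + 192 * \<gamma> * (37 * \<sigma>\<^sup>2 + 12 * D\<^sup>2) / ?\<mu>" .
  next
    fix C
    assume *: "compact C \<and> C \<subseteq> Z \<and> zs \<in> C \<and>
        strongly_monotone_on Z F 0 \<and> strongly_convex_fun_on Z h 0 \<and>
        ereal \<gamma> \<le> 1 / ereal (12 * L * sqrt 2)"
    have step: "288 * (\<gamma>\<^sup>2 * L\<^sup>2) \<le> 1"
      using * by (intro step_size_bound \<gamma> L) auto
    let ?s = "\<lambda>\<omega>. (norm (F (zh 0 \<omega>) - F (zh 1 \<omega>)))\<^sup>2" and ?\<Omega> = "SUP u\<in>C. (norm (z0 - u))\<^sup>2"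
    have s: "integrable M ?s"
      using K by (intro integrable_norm_diff sq_integrable_F zh_sq_integrable zh_in_Z) auto
    have "C \<noteq> {}" and mono: "strongly_monotone_on Z F 0" and C: "compact C" and zsC: "zs \<in> C"
      using * by auto
    have "compact ((\<lambda>u. (norm (z0 - u))\<^sup>2) ` C)"
      by (intro compact_continuous_image continuous_intros C)
    then have "bdd_above ((\<lambda>u. (norm (z0 - u))\<^sup>2) ` C)"
      by (intro bounded_imp_bdd_above compact_imp_bounded)
    \<comment> \<open>A real supremum dominates its terms only over a set bounded above, which
      compactness of \<open>C\<close> provides; \<open>zs\<close> serves as the point of
      comparison.\<close>
    from cSUP_upper[OF zsC this] have \<Omega>: "0 \<le> ?\<Omega>"
      by (rule order_trans[rotated]) simp
    note gap = expected_Gap_bound[OF step K zs zsC C mono]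
    have "(\<integral>\<omega>. real_of_ereal (Gap F h C (zhat \<omega>)) \<partial>M)
        \<le> ?\<Omega> / (\<gamma> * real K) + \<gamma> * (13 * \<sigma>\<^sup>2 + 6 * D\<^sup>2) / 2"
      by (rule gap(3))
    also have "\<dots> \<le> (8 * ?\<Omega> + 72 * \<gamma>\<^sup>2 * (\<integral>\<omega>. ?s \<omega> \<partial>M)) / (\<gamma> * real K)
        + \<gamma> * (216 * D\<^sup>2 + 691 * \<sigma>\<^sup>2)"
    proof (intro add_mono divide_right_mono)
      \<comment> \<open>The initial-discrepancy term is nonnegative, so adding it only enlarges the
        right side.\<close>
      have "0 \<le> 72 * \<gamma>\<^sup>2 * (\<integral>\<omega>. ?s \<omega> \<partial>M)"
        by (intro mult_nonneg_nonneg Bochner_Integration.integral_nonneg) auto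
      then show "?\<Omega> \<le> 8 * ?\<Omega> + 72 * \<gamma>\<^sup>2 * (\<integral>\<omega>. ?s \<omega> \<partial>M)"
        using \<Omega> by linarith
      have "\<gamma> * ((13 * \<sigma>\<^sup>2 + 6 * D\<^sup>2) / 2) \<le> \<gamma> * (216 * D\<^sup>2 + 691 * \<sigma>\<^sup>2)"
        using \<gamma> zero_le_power2[of \<sigma>] zero_le_power2[of D] by (intro mult_left_mono) auto
      then show "\<gamma> * (13 * \<sigma>\<^sup>2 + 6 * D\<^sup>2) / 2 \<le> \<gamma> * (216 * D\<^sup>2 + 691 * \<sigma>\<^sup>2)"
        by simp
    qed (use \<gamma> in auto)
    finally show "let zhat = (\<lambda>\<omega>. (1 / real K) *\<^sub>R (\<Sum>k<K. zh (Suc k) \<omega>));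
             \<sigma>0sq = (\<lambda>\<omega>. (norm (F (zh 0 \<omega>) - F (zh 1 \<omega>)))\<^sup>2)
         in integrable M \<sigma>0sq \<and>
            (AE \<omega> in M. \<bar>Gap F h C (zhat \<omega>)\<bar> \<noteq> \<infinity>) \<and>
            integrable M (\<lambda>\<omega>. real_of_ereal (Gap F h C (zhat \<omega>))) \<and>
            (\<integral>\<omega>. real_of_ereal (Gap F h C (zhat \<omega>)) \<partial>M) \<le>
              (8 * (SUP u\<in>C. (norm (z0 - u))\<^sup>2) + 72 * \<gamma>\<^sup>2 * (\<integral>\<omega>. \<sigma>0sq \<omega> \<partial>M)) / (\<gamma> * real K)
              + \<gamma> * (216 * D\<^sup>2 + 691 * \<sigma>\<^sup>2)"
      using s gap(1,2) unfolding Let_def zhat_def by blast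
  qed
qed

end
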